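(* Let $\tau$ and $\sigma$ be two primitive substitutions having the same non-periodic fixed point. Then there exist positive integers $i$ and $j$ such that $\tau^i$ and $\sigma^j$ have the same eigenvalues, except perhaps $0$ and roots of unity; that is, a complex number which is neither $0$ nor a root of unity is an eigenvalue of $M_\tau^i$ if and only if it is an eigenvalue of $M_\sigma^j$.
   Context: A substitution is a triple $(\tau,A,a)$ where $A$ is a finite alphabet, $\tau:A\to A^+$ is a morphism (extended by concatenation to words and sequences), and $a\in A$ with $\tau(a)$ beginning with $a$; its fixed point is the unique sequence $X$ with first letter $a$ and $\tau(X)=X$. The matrix of $\tau$ is $M_\tau=(m_{i,j})_{i,j\in A}$ with $m_{i,j}$ the number of occurrences of $i$ in $\tau(j)$; eigenvalues of $\tau$ means eigenvalues of $M_\tau$, and $M_{\tau^n}=M_\tau^n$. $\tau$ is primitive if some power of $M_\tau$ has all entries positive. A sequence is non-periodic if it is not of the form $uv^\omega$ with $v$ a non-empty word. *)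

theory Defs
  imports Complex_Main
begin

definition substitution :: "('a \<Rightarrow> 'a list) \<Rightarrow> 'a set \<Rightarrow> 'a \<Rightarrow> bool" where
  "substitution \<tau> A a \<longleftrightarrow> finite A \<and> a \<in> A \<and>
     (\<forall>x\<in>A. \<tau> x \<noteq> [] \<and> set (\<tau> x) \<subseteq> A) \<and> hd (\<tau> a) = a"

text \<open>The image of an infinite sequence under \<open>\<tau>\<close> (concatenation of the images of its letters)
  equals the sequence: every finite concatenation \<open>\<tau>(X 0)\<dots>\<tau>(X (n-1))\<close> is a prefix of \<open>X\<close>.\<close>
definition subst_fixes_seq :: "('a \<Rightarrow> 'a list) \<Rightarrow> (nat \<Rightarrow> 'a) \<Rightarrow> bool" where
  "subst_fixes_seq \<tau> X \<longleftrightarrow>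
     (\<forall>n i. i < length (concat (map (\<tau> \<circ> X) [0..<n])) \<longrightarrow>
            concat (map (\<tau> \<circ> X) [0..<n]) ! i = X i)"

definition fixed_point :: "('a \<Rightarrow> 'a list) \<Rightarrow> 'a set \<Rightarrow> 'a \<Rightarrow> (nat \<Rightarrow> 'a) \<Rightarrow> bool" where
  "fixed_point \<tau> A a X \<longleftrightarrow> (\<forall>n. X n \<in> A) \<and> X 0 = a \<and> subst_fixes_seq \<tau> X"

definition subst_matrix :: "('a \<Rightarrow> 'a list) \<Rightarrow> 'a \<Rightarrow> 'a \<Rightarrow> nat" where
  "subst_matrix \<tau> i j = count_list (\<tau> j) i"

fun mat_pow :: "'a set \<Rightarrow> ('a \<Rightarrow> 'a \<Rightarrow> nat) \<Rightarrow> nat \<Rightarrow> 'a \<Rightarrow> 'a \<Rightarrow> nat" where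
  "mat_pow A M 0 = (\<lambda>i j. if i = j then 1 else 0)"
| "mat_pow A M (Suc n) = (\<lambda>i j. \<Sum>k\<in>A. M i k * mat_pow A M n k j)"

definition primitive :: "('a \<Rightarrow> 'a list) \<Rightarrow> 'a set \<Rightarrow> bool" where
  "primitive \<tau> A \<longleftrightarrow> (\<exists>n\<ge>1. \<forall>i\<in>A. \<forall>j\<in>A. mat_pow A (subst_matrix \<tau>) n i j > 0)"

definition eigenvalue_on :: "'a set \<Rightarrow> ('a \<Rightarrow> 'a \<Rightarrow> nat) \<Rightarrow> complex \<Rightarrow> bool" where
  "eigenvalue_on A M z \<longleftrightarrow> (\<exists>v :: 'a \<Rightarrow> complex. (\<exists>x\<in>A. v x \<noteq> 0) \<and>
      (\<forall>i\<in>A. (\<Sum>j\<in>A. of_nat (M i j) * v j) = z * v i))"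

definition non_periodic :: "(nat \<Rightarrow> 'a) \<Rightarrow> bool" where
  "non_periodic X \<longleftrightarrow> \<not> (\<exists>N p. p > 0 \<and> (\<forall>n\<ge>N. X (n + p) = X n))"

definition root_of_unity :: "complex \<Rightarrow> bool" where
  "root_of_unity z \<longleftrightarrow> (\<exists>k::nat. k > 0 \<and> z ^ k = 1)"

end

theory Submission
  imports Defs "HOL-Library.Sublist" "Jordan_Normal_Form.Char_Poly"
begin

text \<open>Let \<open>u\<close> be a prefix of the fixed point \<open>X\<close> and choose \<open>n\<close> minimal such that \<open>u\<close> is a prefix of
  \<open>\<tau>\<^sup>n(X\<^sub>0)\<close>. Then the \<open>\<tau>\<^sup>n\<close>-image of a return word to the letter \<open>X\<^sub>0\<close> is uniquely a product of
  return words to \<open>u\<close>, and as \<open>X\<close> is not periodic, the number of factors is bounded independently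
  of \<open>u\<close>. Thus only finitely many codings occur, and two prefixes \<open>u\<close>, \<open>u'\<close> have the same coding for
  \<open>\<tau>\<close> and for \<open>\<sigma>\<close> at once. Identifying their return words, the decomposition of return words to
  \<open>u'\<close> into return words to \<open>u\<close> becomes a substitution \<open>\<pi>\<close>. Up to \<open>0\<close> and roots of unity, \<open>\<pi>\<close> has the
  eigenvalues of a power of \<open>\<tau>\<close> and also those of a power of \<open>\<sigma>\<close>: in each comparison the exceptional
  eigenvectors have an orbit with finitely many values.\<close>

section \<open>Return words\<close>

text \<open>The words leading from one occurrence of \<open>u\<close> to another, overlaps included:
  \<open>w @ u\<close> begins and ends with \<open>u\<close>. This form needs no case distinction on
  whether \<open>w\<close> is shorter than \<open>u\<close>.\<close>

definition return_monoid :: "'a list \<Rightarrow> 'a list set" where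
  "return_monoid u = {w. prefix u (w @ u)}"

text \<open>The free basis of \<open>return_monoid u\<close>: the two occurrences of
  \<open>u\<close> at the ends of \<open>r @ u\<close> are consecutive.\<close>

definition return_words :: "'a list \<Rightarrow> 'a list set" where
  "return_words u = {r \<in> return_monoid u. r \<noteq> [] \<and>
     (\<forall>i. 0 < i \<and> i < length r \<longrightarrow> \<not> prefix u (drop i (r @ u)))}"

definition return_dec :: "'a list \<Rightarrow> 'a list \<Rightarrow> 'a list list" where
  "return_dec u w = (THE rs. set rs \<subseteq> return_words u \<and> concat rs = w)"

lemma return_monoid_Nil [simp]: "[] \<in> return_monoid u"
  by (simp add: return_monoid_def)

lemma return_words_subset: "return_words u \<subseteq> return_monoid u"
  by (auto simp: return_words_def)

lemma return_monoid_append: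
  assumes "v \<in> return_monoid u" "w \<in> return_monoid u"
  shows "v @ w \<in> return_monoid u"
proof -
  obtain x where x: "w @ u = u @ x" using assms(2) by (auto simp: return_monoid_def prefix_def)
  obtain y where y: "v @ u = u @ y" using assms(1) by (auto simp: return_monoid_def prefix_def)
  have "(v @ w) @ u = u @ y @ x" using x y by (metis append.assoc)
  then show ?thesis by (simp add: return_monoid_def)
qed

lemma return_monoid_concat:
  "set ws \<subseteq> return_monoid u \<Longrightarrow> concat ws \<in> return_monoid u"
  by (induction ws) (auto intro: return_monoid_append)

lemma prefix_return_monoid:
  assumes "v @ w \<in> return_monoid u" "prefix u (w @ u)"
  shows "v \<in> return_monoid u"
proof -
  have "prefix (v @ u) (v @ w @ u)" using assms(2) by simp
  moreover have "prefix u (v @ w @ u)" using assms(1) by (simp add: return_monoid_def)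
  ultimately have "prefix u (v @ u)" using prefix_length_prefix[of u "v @ w @ u" "v @ u"] by simp
  then show ?thesis by (simp add: return_monoid_def)
qed

text \<open>An occurrence of \<open>v\<close> is also one of its prefix \<open>u\<close>. Hence
  return words to a long prefix can be cut into return words to a shorter one.\<close>

lemma return_monoid_mono:
  assumes "prefix u v"
  shows "return_monoid v \<subseteq> return_monoid u"
proof
  fix w assume w: "w \<in> return_monoid v"
  obtain x where x: "v = u @ x" using assms by (auto simp: prefix_def)
  have "prefix u (w @ u @ x)" using w x by (auto simp: return_monoid_def prefix_def)
  moreover have "prefix (w @ u) (w @ u @ x)" by simp
  ultimately have "prefix u (w @ u)" using prefix_length_prefix[of u "w @ u @ x" "w @ u"] by simp
  then show "w \<in> return_monoid u" by (simp add: return_monoid_def)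
qed

text \<open>Cut \<open>w\<close> at the first positive position where \<open>u\<close> occurs in
  \<open>w @ u\<close>: minimality makes the piece a return word, and the rest is shorter.\<close>

lemma return_dec_exists:
  "w \<in> return_monoid u \<Longrightarrow> \<exists>rs. set rs \<subseteq> return_words u \<and> concat rs = w"
proof (induction "length w" arbitrary: w rule: less_induct)
  case less
  show ?case
  proof (cases "w = []")
    case True
    then show ?thesis by (intro exI[of _ "[]"]) auto
  next
    case False
    let ?P = "\<lambda>i. 0 < i \<and> i \<le> length w \<and> prefix u (drop i (w @ u))"
    define i where "i = (LEAST i. ?P i)"
    have ex: "?P (length w)" using False by simp
    have i: "?P i" unfolding i_def by (rule LeastI[of ?P, OF ex])
    have least: "\<not> ?P j" if "j < i" for j using that not_less_Least unfolding i_def by blast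
    define r where "r = take i w"
    define v where "v = drop i w"
    have w: "w = r @ v" and lr: "length r = i" using i by (auto simp: r_def v_def)
    have v: "v \<in> return_monoid u" using i by (auto simp add: v_def return_monoid_def)
    have r: "r \<in> return_monoid u"
      using prefix_return_monoid[of r v u] less.prems v w by (auto simp: return_monoid_def)
    have "\<not> prefix u (drop j (r @ u))" if j: "0 < j" "j < i" for j
    proof
      assume a: "prefix u (drop j (r @ u))"
      have "prefix (r @ u) (w @ u)" using v w by (auto simp: return_monoid_def)
      then obtain z where "w @ u = (r @ u) @ z" by (auto simp: prefix_def)
      then have "drop j (w @ u) = drop j (r @ u) @ z" using j lr by simp
      then have "prefix u (drop j (w @ u))" using a by (metis prefix_prefix)
      then show False using least[of j] j i by auto
    qed
    then have r': "r \<in> return_words u" using r i lr by (auto simp: return_words_def)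
    obtain rs where "set rs \<subseteq> return_words u" "concat rs = v"
      using less.hyps[OF _ v] i w lr by (metis add_less_same_cancel2 length_append less_add_same_cancel2)
    then show ?thesis using r' w by (intro exI[of _ "r # rs"]) auto
  qed
qed

text \<open>If one were shorter, the \<open>u\<close> following it would lie strictly between the
  two consecutive occurrences of \<open>u\<close> that bound the other.\<close>

lemma return_words_eq:
  assumes "r @ w = r' @ w'" "r \<in> return_words u" "r' \<in> return_words u"
    "w \<in> return_monoid u" "w' \<in> return_monoid u"
  shows "r = r'"
proof -
  have no: "\<not> length r < length r'"
    if e: "r @ w = r' @ w'" and r: "r \<in> return_words u" and r': "r' \<in> return_words u"
      and w: "w \<in> return_monoid u" and w': "w' \<in> return_monoid u" for r r' w w'
  proof
    assume l: "length r < length r'"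
    have "prefix (r @ u) (r @ w @ u)" using w by (simp add: return_monoid_def)
    moreover have "prefix (r' @ u) (r' @ w' @ u)" using w' by (simp add: return_monoid_def)
    moreover have "r @ w @ u = r' @ w' @ u" using e by (metis append.assoc)
    ultimately have "prefix (r @ u) (r' @ u)" using l
      by (metis length_append less_imp_le_nat add_le_mono1 prefix_length_prefix)
    then obtain z where "r' @ u = r @ u @ z" by (auto simp: prefix_def)
    then have "prefix u (drop (length r) (r' @ u))" by (simp add: prefix_def)
    then show False using r' l r by (auto simp: return_words_def)
  qed
  have "length r = length r'"
    using no[OF assms] no[OF assms(1)[symmetric] assms(3,2,5,4)] by simp
  then show ?thesis using assms(1) by simp
qed

lemma return_dec_unique:
  assumes "set rs \<subseteq> return_words u" "set rs' \<subseteq> return_words u" "concat rs = concat rs'"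
  shows "rs = rs'"
  using assms
proof (induction rs arbitrary: rs')
  case Nil
  then show ?case by (cases rs') (auto simp: return_words_def)
next
  case (Cons r rs)
  from Cons.prems obtain r' rs'' where rs': "rs' = r' # rs''"
    by (cases rs') (auto simp: return_words_def)
  have m: "concat rs \<in> return_monoid u" "concat rs'' \<in> return_monoid u"
    using Cons.prems rs' return_words_subset by (auto intro!: return_monoid_concat)
  have "r = r'" using return_words_eq[of r "concat rs" r' "concat rs''" u] Cons.prems rs' m by auto
  then show ?case using Cons rs' by auto
qed

lemma return_dec_concat [simp]:
  assumes "set rs \<subseteq> return_words u"
  shows "return_dec u (concat rs) = rs"
  unfolding return_dec_def using assms return_dec_unique by (intro the_equality) blast+

lemma return_dec:
  assumes "w \<in> return_monoid u"
  shows "set (return_dec u w) \<subseteq> return_words u" "concat (return_dec u w) = w"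
  using return_dec_exists[OF assms] by auto

lemma return_dec_append:
  assumes "v \<in> return_monoid u" "w \<in> return_monoid u"
  shows "return_dec u (v @ w) = return_dec u v @ return_dec u w"
  using return_dec[OF assms(1)] return_dec[OF assms(2)]
    return_dec_concat[of "return_dec u v @ return_dec u w" u] by auto

lemma return_dec_Nil [simp]: "return_dec u [] = []"
  using return_dec_concat[of "[]" u] by simp

lemma return_dec_concat_map:
  assumes "set ws \<subseteq> return_monoid u"
  shows "return_dec u (concat ws) = concat (map (return_dec u) ws)"
  using assms by (induction ws) (auto simp: return_dec_append return_monoid_concat)

lemma return_dec_return_word:
  assumes "r \<in> return_words u" shows "return_dec u r = [r]"
  using return_dec_concat[of "[r]" u] assms by simp

text \<open>Both ends of \<open>s\<close> sit at occurrences of \<open>u\<close>, so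
  \<open>w\<close> splits inside the monoid before and after \<open>s\<close>, and its decomposition
  splits there too.\<close>

lemma occurrence_in_return_dec:
  assumes w: "w \<in> return_monoid u" and s: "s \<in> return_words u"
    and e: "w @ u = p @ s @ u @ q" and l: "length (p @ s) \<le> length w"
  shows "s \<in> set (return_dec u w)"
proof -
  define v where "v = drop (length (p @ s)) w"
  have w': "w = p @ s @ v"
    using e l v_def
    by (metis append.assoc append_eq_append_conv_if append_take_drop_id)
  have "v @ u = u @ q" using e w' by simp
  then have v: "v \<in> return_monoid u" by (simp add: return_monoid_def)
  have sv: "s @ v \<in> return_monoid u" using s v return_words_subset return_monoid_append by blast
  have p: "p \<in> return_monoid u"
    using prefix_return_monoid[of p "s @ v" u] w w' sv by (simp add: return_monoid_def)
  have "return_dec u w = return_dec u p @ [s] @ return_dec u v"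
    using w' p s v sv return_words_subset[of u]
    by (auto simp: return_dec_append return_dec_return_word subset_iff)
  then show ?thesis by simp
qed

text \<open>As a prefix of \<open>s @ u\<close>, the word \<open>u\<close> agrees with its own shift
  by \<open>length s\<close>.\<close>

lemma period_of_return_monoid:
  assumes "s \<in> return_monoid u" "i + length s < length u"
  shows "u ! (i + length s) = u ! i"
proof -
  obtain z where "s @ u = u @ z" using assms(1) by (auto simp: return_monoid_def prefix_def)
  then have "(s @ u) ! (i + length s) = u ! (i + length s)" using assms(2) by (simp add: nth_append)
  then show ?thesis by (simp add: nth_append)
qed

section \<open>Return words to a single letter\<close>

lemma return_monoid_singleton:
  "w \<in> return_monoid [a] \<longleftrightarrow> w = [] \<or> hd w = a"
  by (cases w) (auto simp: return_monoid_def)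

lemma return_words_singleton:
  "r \<in> return_words [a] \<longleftrightarrow> r \<noteq> [] \<and> hd r = a \<and> a \<notin> set (tl r)"
proof (cases r)
  case (Cons b w)
  have "(\<forall>i. 0 < i \<and> i < Suc (length w) \<longrightarrow> \<not> prefix [a] (drop i (b # w @ [a]))) \<longleftrightarrow>
    (\<forall>j<length w. \<not> prefix [a] (drop j (w @ [a])))" (is "?l \<longleftrightarrow> ?r")
  proof
    assume ?l
    then show ?r by (metis Suc_less_eq drop_Suc_Cons zero_less_Suc)
  next
    assume r: ?r
    show ?l
    proof (intro allI impI)
      fix i assume "0 < i \<and> i < Suc (length w)"
      then show "\<not> prefix [a] (drop i (b # w @ [a]))" using r by (cases i) auto
    qed
  qed
  also have "\<dots> \<longleftrightarrow> (\<forall>j<length w. w ! j \<noteq> a)"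
    by (auto simp: Cons_nth_drop_Suc[symmetric])
  also have "\<dots> \<longleftrightarrow> a \<notin> set w" by (auto simp: in_set_conv_nth)
  finally show ?thesis using Cons
    by (simp add: return_words_def return_monoid_singleton del: drop_append)
qed (simp add: return_words_def)

text \<open>Appending \<open>v\<close> glues its part before the first \<open>a\<close> to the last return word of \<open>w\<close>, so only
  that one return word changes.\<close>
lemma count_return_dec_append:
  assumes "w \<in> return_monoid [a]" "w \<noteq> []"
  obtains d where "d \<in> {-1..1}"
    "int (count_list (return_dec [a] (w @ v)) g) =
       int (count_list (return_dec [a] w) g) +
       int (count_list (return_dec [a] (dropWhile (\<lambda>x. x \<noteq> a) v)) g) + d"
proof -
  define h where "h = takeWhile (\<lambda>x. x \<noteq> a) v"
  define k where "k = dropWhile (\<lambda>x. x \<noteq> a) v"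
  have v: "v = h @ k" by (simp add: h_def k_def)
  have ah: "a \<notin> set h" unfolding h_def by (metis (full_types) set_takeWhileD)
  have k: "k \<in> return_monoid [a]"
    using hd_dropWhile[of "\<lambda>x. x \<noteq> a" v] by (auto simp: return_monoid_singleton k_def)
  define rs where "rs = butlast (return_dec [a] w)"
  define r where "r = last (return_dec [a] w)"
  have "return_dec [a] w \<noteq> []" using return_dec(2)[OF assms(1)] assms(2) by auto
  then have dw: "return_dec [a] w = rs @ [r]" by (simp add: rs_def r_def)
  have rr: "set rs \<subseteq> return_words [a]" "r \<in> return_words [a]"
    using return_dec(1)[OF assms(1)] dw by auto
  have rh: "r @ h \<in> return_words [a]"
    using rr(2) ah by (cases r) (auto simp: return_words_singleton)
  have "w @ v = concat (rs @ [r @ h] @ return_dec [a] k)"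
    using return_dec(2)[OF assms(1)] return_dec(2)[OF k] dw v by simp
  moreover have "set (rs @ [r @ h] @ return_dec [a] k) \<subseteq> return_words [a]"
    using rr rh return_dec(1)[OF k] by auto
  ultimately have "return_dec [a] (w @ v) = rs @ [r @ h] @ return_dec [a] k"
    using return_dec_concat by metis
  then show ?thesis using dw
    by (intro that[of "(if r @ h = g then 1 else 0) - (if r = g then 1 else 0)"]) (auto simp: k_def)
qed

section \<open>Eigenvalues of intertwined substitutions\<close>

text \<open>After an enumeration of \<open>A\<close>, this holds because a matrix and its transpose
  share their characteristic polynomial.\<close>

lemma eigenvalue_on_transpose:
  fixes A :: "'a set" and M :: "'a \<Rightarrow> 'a \<Rightarrow> nat"
  assumes "finite A"
  shows "eigenvalue_on A (\<lambda>i j. M j i) z \<longleftrightarrow> eigenvalue_on A M z"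
proof -
  define n where "n = card A"
  obtain f where f: "bij_betw f {0..<n} A"
    using ex_bij_betw_nat_finite[OF assms] unfolding n_def by blast
  have *: "eigenvalue_on A N z \<longleftrightarrow> eigenvalue (mat n n (\<lambda>(i, j). of_nat (N (f i) (f j)))) z"
    (is "_ \<longleftrightarrow> eigenvalue ?N z") for N :: "'a \<Rightarrow> 'a \<Rightarrow> nat"
  proof
    assume "eigenvalue_on A N z"
    then obtain v where v: "\<exists>x\<in>A. v x \<noteq> 0" "\<forall>i\<in>A. (\<Sum>j\<in>A. of_nat (N i j) * v j) = z * v i"
      by (auto simp: eigenvalue_on_def)
    have "eigenvector ?N (vec n (v \<circ> f)) z"
      unfolding eigenvector_def
    proof (intro conjI)
      obtain k where "k < n" "v (f k) \<noteq> 0"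
        using v(1) f by (metis atLeastLessThan_iff bij_betw_iff_bijections)
      then have "vec n (v \<circ> f) $ k \<noteq> 0\<^sub>v n $ k" by simp
      then show "vec n (v \<circ> f) \<noteq> 0\<^sub>v (dim_row ?N)" by auto
      show "?N *\<^sub>v vec n (v \<circ> f) = z \<cdot>\<^sub>v vec n (v \<circ> f)"
      proof (rule eq_vecI)
        fix i assume "i < dim_vec (z \<cdot>\<^sub>v vec n (v \<circ> f))"
        then have i: "i < n" by simp
        then have fi: "f i \<in> A" using f by (auto dest: bij_betwE)
        have "(?N *\<^sub>v vec n (v \<circ> f)) $ i = (\<Sum>k\<in>{0..<n}. of_nat (N (f i) (f k)) * v (f k))"
          using i by (simp add: scalar_prod_def)
        also have "\<dots> = (\<Sum>j\<in>A. of_nat (N (f i) j) * v j)"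
          by (rule sum.reindex_bij_betw[OF f])
        finally show "(?N *\<^sub>v vec n (v \<circ> f)) $ i = (z \<cdot>\<^sub>v vec n (v \<circ> f)) $ i"
          using v(2) fi i by simp
      qed simp
    qed simp
    then show "eigenvalue ?N z" by (auto simp: eigenvalue_def)
  next
    assume "eigenvalue ?N z"
    then obtain w where w: "w \<in> carrier_vec n" "w \<noteq> 0\<^sub>v n" "?N *\<^sub>v w = z \<cdot>\<^sub>v w"
      by (auto simp: eigenvalue_def eigenvector_def)
    define g where "g = inv_into {0..<n} f"
    have gf: "g (f i) = i" if "i < n" for i
      using f that by (simp add: g_def bij_betw_def)
    show "eigenvalue_on A N z" unfolding eigenvalue_on_def
    proof (intro exI[of _ "\<lambda>x. w $ g x"] conjI ballI)
      obtain k where "k < n" "w $ k \<noteq> 0" using w(1,2) by (metis carrier_vecD eq_vecI index_zero_vec)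
      then show "\<exists>x\<in>A. w $ g x \<noteq> 0"
        using f gf by (intro bexI[of _ "f k"]) (auto dest: bij_betwE)
      fix x assume "x \<in> A"
      then obtain i where i: "i < n" "x = f i"
        using f by (metis atLeastLessThan_iff bij_betw_iff_bijections)
      have "(\<Sum>j\<in>A. of_nat (N x j) * w $ g j) = (\<Sum>k\<in>{0..<n}. of_nat (N x (f k)) * w $ g (f k))"
        by (rule sum.reindex_bij_betw[OF f, symmetric])
      also have "\<dots> = (\<Sum>k\<in>{0..<n}. of_nat (N (f i) (f k)) * w $ k)"
        by (rule sum.cong) (auto simp: gf i)
      also have "\<dots> = (?N *\<^sub>v w) $ i" using i w(1) by (simp add: scalar_prod_def)
      also have "\<dots> = z * w $ i" using w i by simp
      finally show "(\<Sum>j\<in>A. of_nat (N x j) * w $ g j) = z * w $ g x" using i gf by simp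
    qed
  qed
  let ?A = "mat n n (\<lambda>(i, j). of_nat (M (f i) (f j))) :: complex mat"
  have "eigenvalue (transpose_mat ?A) z \<longleftrightarrow> eigenvalue ?A z"
    by (simp add: eigenvalue_root_char_poly[of _ n] char_poly_transpose_mat[of _ n])
  moreover have "transpose_mat ?A = mat n n (\<lambda>(i, j). of_nat (M (f j) (f i)))" by auto
  ultimately show ?thesis using * by simp
qed

lemma eigenvalue_on_cong:
  assumes "\<And>i j. i \<in> A \<Longrightarrow> j \<in> A \<Longrightarrow> M i j = N i j"
  shows "eigenvalue_on A M z \<longleftrightarrow> eigenvalue_on A N z"
  unfolding eigenvalue_on_def using assms by simp

text \<open>Two powers of \<open>z\<close> must coincide, which leaves only \<open>0\<close> and
  roots of unity. This is how the exceptional eigenvalues enter in \<open>eigenvalue_pull\<close>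
  and \<open>return_subst_letter_counts\<close>.\<close>

lemma power_orbit_finite:
  fixes z c :: complex
  assumes "finite S" "c \<noteq> 0" "\<And>k. z ^ k * c \<in> S"
  shows "z = 0 \<or> root_of_unity z"
proof -
  have "range (\<lambda>k. z ^ k) \<subseteq> (\<lambda>s. s / c) ` S"
  proof
    fix x assume "x \<in> range (\<lambda>k. z ^ k)"
    then obtain k where "x = (z ^ k * c) / c" using assms(2) by auto
    then show "x \<in> (\<lambda>s. s / c) ` S" using assms(3) by blast
  qed
  then have "finite (range (\<lambda>k. z ^ k))" using assms(1) finite_surj by blast
  then have "\<not> inj (\<lambda>k. z ^ k)" using finite_imageD infinite_UNIV_nat by blast
  then obtain k l where "z ^ k = z ^ l" "k \<noteq> l" by (auto simp: inj_def)
  then obtain k l where kl: "z ^ k = z ^ l" "k < l" by (metis linorder_neqE_nat)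
  have "z ^ l = z ^ k * z ^ (l - k)" using kl(2) by (simp flip: power_add)
  then have "z = 0 \<or> z ^ (l - k) = 1" using kl(1) by auto
  then show ?thesis using kl(2) unfolding root_of_unity_def by (metis zero_less_diff)
qed

section \<open>Counting letters in images of words\<close>

lemma of_nat_count_list_concat_map:
  "of_nat (count_list (concat (map f w)) x) = sum_list (map (\<lambda>g. of_nat (count_list (f g) x)) w)"
  by (induction w) auto

lemma sum_list_concat_map:
  fixes y :: "'b \<Rightarrow> 'c::comm_monoid_add"
  shows "sum_list (map y (concat (map f w))) = sum_list (map (\<lambda>x. sum_list (map y (f x))) w)"
  by (induction w) auto

lemma sum_list_map_count:
  fixes y :: "'b \<Rightarrow> 'c::semiring_1"
  assumes "finite R" "set l \<subseteq> R"
  shows "sum_list (map y l) = (\<Sum>t\<in>R. of_nat (count_list l t) * y t)"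
  using assms(2)
proof (induction l)
  case (Cons x l)
  have "(\<Sum>t\<in>R. of_nat (count_list (x # l) t) * y t) =
      (\<Sum>t\<in>R. (if t = x then y t else 0) + of_nat (count_list l t) * y t)"
    by (rule sum.cong) (auto simp: algebra_simps)
  also have "\<dots> = y x + (\<Sum>t\<in>R. of_nat (count_list l t) * y t)"
    using Cons.prems assms(1) by (simp add: sum.distrib)
  finally show ?case using Cons by simp
qed simp

text \<open>Through the transpose an eigenvector becomes a weight on letters whose sums along words
  are multiplied by \<open>z\<close> under \<open>\<pi>\<close>.\<close>

lemma eigenvalue_on_left_iff:
  assumes "finite R" "\<And>s. s \<in> R \<Longrightarrow> set (\<pi> s) \<subseteq> R"
  shows "eigenvalue_on R (subst_matrix \<pi>) z \<longleftrightarrow>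
    (\<exists>y. (\<exists>x\<in>R. y x \<noteq> 0) \<and> (\<forall>s\<in>R. sum_list (map y (\<pi> s)) = z * y s))"
proof -
  have "eigenvalue_on R (subst_matrix \<pi>) z \<longleftrightarrow> eigenvalue_on R (\<lambda>i j. subst_matrix \<pi> j i) z"
    using eigenvalue_on_transpose[OF assms(1), of "subst_matrix \<pi>"] by simp
  then show ?thesis
    by (simp add: eigenvalue_on_def subst_matrix_def sum_list_map_count[OF assms(1) assms(2)])
qed

text \<open>Exchanging the two sums moves the action of \<open>t\<close> onto the eigenvector
  \<open>x\<close>. Since \<open>f\<close> is arbitrary, it may count letters in further
  images.\<close>

lemma right_eigenvector_pairing:
  fixes x f :: "'g \<Rightarrow> complex"
  assumes fin: "finite G" and t: "\<And>g. g \<in> G \<Longrightarrow> set (t g) \<subseteq> G"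
    and x: "\<And>i. i \<in> G \<Longrightarrow> (\<Sum>j\<in>G. of_nat (subst_matrix t i j) * x j) = z * x i"
  shows "(\<Sum>h\<in>G. x h * sum_list (map f (t h))) = z * (\<Sum>h\<in>G. x h * f h)"
proof -
  have "(\<Sum>h\<in>G. x h * sum_list (map f (t h))) =
      (\<Sum>h\<in>G. \<Sum>g\<in>G. x h * (of_nat (count_list (t h) g) * f g))"
    by (intro sum.cong) (auto simp: sum_list_map_count[OF fin t] sum_distrib_left)
  also have "\<dots> = (\<Sum>g\<in>G. \<Sum>h\<in>G. x h * (of_nat (count_list (t h) g) * f g))"
    by (rule sum.swap)
  also have "\<dots> = (\<Sum>g\<in>G. (\<Sum>h\<in>G. of_nat (subst_matrix t g h) * x h) * f g)"
    by (auto simp: sum_distrib_left subst_matrix_def algebra_simps intro!: sum.cong)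
  also have "\<dots> = (\<Sum>g\<in>G. z * (x g * f g))" by (rule sum.cong) (auto simp: x)
  finally show ?thesis by (simp add: sum_distrib_left)
qed

text \<open>Extended to words, \<open>\<kappa>\<close> is a semiconjugacy from \<open>t\<close> to
  \<open>\<pi>\<close>. Its two uses are return words spelled in letters and iterates coded by
  return words to a prefix.\<close>

locale intertwined =
  fixes G :: "'g set" and R :: "'r set" and t :: "'g \<Rightarrow> 'g list" and \<pi> :: "'r \<Rightarrow> 'r list"
    and \<kappa> :: "'g \<Rightarrow> 'r list"
  assumes finG: "finite G" and finR: "finite R"
    and t: "\<And>g. g \<in> G \<Longrightarrow> set (t g) \<subseteq> G"
    and \<pi>: "\<And>s. s \<in> R \<Longrightarrow> set (\<pi> s) \<subseteq> R"
    and \<kappa>: "\<And>g. g \<in> G \<Longrightarrow> set (\<kappa> g) \<subseteq> R"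
    and cover: "R \<subseteq> (\<Union>g\<in>G. set (\<kappa> g))"
    and commute: "\<And>g. g \<in> G \<Longrightarrow> concat (map \<pi> (\<kappa> g)) = concat (map \<kappa> (t g))"
begin

lemma commute_words:
  "set gs \<subseteq> G \<Longrightarrow> concat (map \<pi> (concat (map \<kappa> gs))) = concat (map \<kappa> (concat (map t gs)))"
  by (induction gs) (auto simp: commute)

text \<open>If a left eigenvector \<open>y\<close> of \<open>\<pi>\<close> vanishes on all \<open>\<kappa> g\<close>, its sums along prefixes of words
  \<open>\<kappa>(g\<^sub>1)\<kappa>(g\<^sub>2)\<dots>\<close> take finitely many values, although \<open>\<pi>\<close> multiplies them
    by the eigenvalue.\<close>
lemma eigenvalue_pull:
  assumes z: "z \<noteq> 0" "\<not> root_of_unity z" and ev: "eigenvalue_on R (subst_matrix \<pi>) z"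
  shows "eigenvalue_on G (subst_matrix t) z"
proof -
  have "\<exists>y. (\<exists>x\<in>R. y x \<noteq> 0) \<and> (\<forall>s\<in>R. sum_list (map y (\<pi> s)) = z * y s)"
    using ev eigenvalue_on_left_iff[of R \<pi> z] finR \<pi> by simp
  then obtain y where y0: "\<exists>x\<in>R. y x \<noteq> 0" and y: "\<And>s. s \<in> R \<Longrightarrow> sum_list (map y (\<pi> s)) = z * y s"
    by blast
  define Y where "Y l = sum_list (map y l)" for l
  have Y_app: "Y (k @ l) = Y k + Y l" for k l by (simp add: Y_def)
  have Y\<pi>: "Y (concat (map \<pi> l)) = z * Y l" if "set l \<subseteq> R" for l
    using that by (induction l) (auto simp: Y_def y algebra_simps)
  have "\<exists>g\<in>G. Y (\<kappa> g) \<noteq> 0"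
  proof (rule ccontr)
    assume "\<not> (\<exists>g\<in>G. Y (\<kappa> g) \<noteq> 0)"
    then have Y0: "Y (\<kappa> g) = 0" if "g \<in> G" for g using that by blast
    define P where "P = {l. \<exists>gs. set gs \<subseteq> G \<and> prefix l (concat (map \<kappa> gs))}"
    \<comment> \<open>Whole words \<open>\<kappa> g\<close> contribute nothing, so only a prefix of
      the last one counts; \<open>0\<close> is the sum over the empty word.\<close>
    define S where "S = insert 0 (Y ` (\<Union>g\<in>G. set (prefixes (\<kappa> g))))"
    have finS: "finite S" using finG by (auto simp: S_def)
    have "Y l \<in> S" if "set gs \<subseteq> G" "prefix l (concat (map \<kappa> gs))" for l gs
      using that
    proof (induction gs arbitrary: l)
      case Nil
      then show ?case by (simp add: S_def Y_def)
    next
      case (Cons g gs)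
      then have "prefix l (\<kappa> g @ concat (map \<kappa> gs))" by simp
      then consider "prefix l (\<kappa> g)" | k where "l = \<kappa> g @ k" "prefix k (concat (map \<kappa> gs))"
        by (auto simp: prefix_append)
      then show ?case
      proof cases
        case 1
        then have "l \<in> (\<Union>g\<in>G. set (prefixes (\<kappa> g)))" using Cons.prems by auto
        then show ?thesis unfolding S_def by blast
      next
        case 2
        then show ?thesis using Cons Y0[of g] by (simp add: Y_app)
      qed
    qed
    then have PS: "Y l \<in> S" if "l \<in> P" for l using that by (auto simp: P_def)
    have PR: "set l \<subseteq> R" if l: "l \<in> P" for l
    proof -
      obtain gs where "set gs \<subseteq> G" "prefix l (concat (map \<kappa> gs))" using l by (auto simp: P_def)
      then have "set l \<subseteq> set (concat (map \<kappa> gs))" by (intro set_mono_prefix)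
      also have "\<dots> \<subseteq> R" using \<open>set gs \<subseteq> G\<close> \<kappa> by auto
      finally show ?thesis .
    qed
    have P\<pi>: "concat (map \<pi> l) \<in> P" if l: "l \<in> P" for l
    proof -
      obtain gs m where gs: "set gs \<subseteq> G" "concat (map \<kappa> gs) = l @ m"
        using l unfolding P_def prefix_def by blast
      have "prefix (concat (map \<pi> l)) (concat (map \<pi> (concat (map \<kappa> gs))))" by (simp add: gs(2))
      also have "\<dots> = concat (map \<kappa> (concat (map t gs)))" by (rule commute_words[OF gs(1)])
      finally have "prefix (concat (map \<pi> l)) (concat (map \<kappa> (concat (map t gs))))" .
      moreover have "set (concat (map t gs)) \<subseteq> G" using gs(1) t by auto
      ultimately show ?thesis unfolding P_def mem_Collect_eq by (intro exI conjI)
    qed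
    obtain s where s: "s \<in> R" "y s \<noteq> 0" using y0 by blast
    then obtain g where g: "g \<in> G" "s \<in> set (\<kappa> g)" using cover by blast
    then obtain l m where lm: "\<kappa> g = l @ s # m" by (meson split_list)
    \<comment> \<open>The two prefixes differ by a letter of non-zero weight, so their sums cannot
      both vanish.\<close>
    have "Y (l @ [s]) = Y l + y s" by (simp add: Y_def)
    then have "Y l \<noteq> 0 \<or> Y (l @ [s]) \<noteq> 0" using s(2) by auto
    moreover have "prefix l (\<kappa> g)" "prefix (l @ [s]) (\<kappa> g)" by (auto simp: lm)
    ultimately obtain l' where l': "prefix l' (\<kappa> g)" "Y l' \<noteq> 0" by blast
    then have l'P: "l' \<in> P" unfolding P_def using g(1) l'(1) by (simp add: exI[of _ "[g]"])
    have "\<exists>l\<in>P. Y l = z ^ k * Y l'" for k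
    proof (induction k)
      case 0
      show ?case using l'P by auto
    next
      case (Suc k)
      then obtain l where "l \<in> P" "Y l = z ^ k * Y l'" by blast
      then show ?case using P\<pi>[of l] Y\<pi>[OF PR[of l]] by (intro bexI[of _ "concat (map \<pi> l)"]) auto
    qed
    then have "z ^ k * Y l' \<in> S" for k using PS by metis
    then show False using power_orbit_finite[OF finS l'(2)] z by blast
  qed
  \<comment> \<open>Commutation makes \<open>Y (\<kappa> g)\<close>, as a function of
    \<open>g\<close>, a left eigenvector of \<open>t\<close>.\<close>
  moreover have "sum_list (map (\<lambda>g. Y (\<kappa> g)) (t g)) = z * Y (\<kappa> g)" if g: "g \<in> G" for g
    using Y\<pi>[OF \<kappa>[OF g]] commute[OF g] by (simp add: Y_def sum_list_concat_map)
  ultimately have "\<exists>y. (\<exists>x\<in>G. y x \<noteq> 0) \<and> (\<forall>g\<in>G. sum_list (map y (t g)) = z * y g)"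
    by (intro exI[of _ "\<lambda>g. Y (\<kappa> g)"]) auto
  then show ?thesis using eigenvalue_on_left_iff[of G t z] finG t by simp
qed

text \<open>The incidence matrix of \<open>\<kappa>\<close> carries \<open>x\<close> to a candidate
  eigenvector of \<open>\<pi>\<close>, and \<open>f\<close> certifies that this image is not
  zero.\<close>

lemma eigenvalue_push:
  fixes x :: "'g \<Rightarrow> complex" and f :: "'r \<Rightarrow> complex"
  assumes x: "\<And>i. i \<in> G \<Longrightarrow> (\<Sum>j\<in>G. of_nat (subst_matrix t i j) * x j) = z * x i"
    and f: "(\<Sum>h\<in>G. x h * sum_list (map f (\<kappa> h))) \<noteq> 0"
  shows "eigenvalue_on R (subst_matrix \<pi>) z"
proof -
  define v where "v s = (\<Sum>h\<in>G. x h * of_nat (count_list (\<kappa> h) s))" for s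
  have pair: "(\<Sum>h\<in>G. x h * sum_list (map f (\<kappa> h))) = (\<Sum>s\<in>R. f s * v s)"
    for f :: "'r \<Rightarrow> complex"
  proof -
    have "(\<Sum>h\<in>G. x h * sum_list (map f (\<kappa> h))) =
        (\<Sum>h\<in>G. \<Sum>s\<in>R. x h * (of_nat (count_list (\<kappa> h) s) * f s))"
      by (intro sum.cong) (auto simp: sum_list_map_count[OF finR \<kappa>] sum_distrib_left)
    also have "\<dots> = (\<Sum>s\<in>R. \<Sum>h\<in>G. x h * (of_nat (count_list (\<kappa> h) s) * f s))"
      by (rule sum.swap)
    finally show ?thesis by (simp add: v_def sum_distrib_left algebra_simps)
  qed
  have "\<exists>s\<in>R. v s \<noteq> 0"
  proof (rule ccontr)
    assume "\<not> (\<exists>s\<in>R. v s \<noteq> 0)"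
    then have "(\<Sum>s\<in>R. f s * v s) = 0" by simp
    then show False using f pair[of f] by simp
  qed
  moreover have "(\<Sum>j\<in>R. of_nat (subst_matrix \<pi> s j) * v j) = z * v s" if "s \<in> R" for s
  proof -
    have "(\<Sum>j\<in>R. of_nat (subst_matrix \<pi> s j) * v j) =
        (\<Sum>h\<in>G. x h * sum_list (map (\<lambda>j. of_nat (count_list (\<pi> j) s)) (\<kappa> h)))"
      using pair[of "\<lambda>j. of_nat (count_list (\<pi> j) s)"] by (simp add: subst_matrix_def)
    also have "\<dots> = (\<Sum>h\<in>G. x h * of_nat (count_list (concat (map \<pi> (\<kappa> h))) s))"
      by (simp only: of_nat_count_list_concat_map)
    also have "\<dots> = (\<Sum>h\<in>G. x h * of_nat (count_list (concat (map \<kappa> (t h))) s))"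
      by (simp add: commute)
    also have "\<dots> = (\<Sum>h\<in>G. x h * sum_list (map (\<lambda>g. of_nat (count_list (\<kappa> g) s)) (t h)))"
      by (simp only: of_nat_count_list_concat_map)
    also have "\<dots> = z * v s" unfolding v_def by (rule right_eigenvector_pairing[OF finG t x])
    finally show ?thesis .
  qed
  ultimately show ?thesis unfolding eigenvalue_on_def by blast
qed

end

section \<open>Return words of a fixed point\<close>

definition subst_pow :: "('a \<Rightarrow> 'a list) \<Rightarrow> nat \<Rightarrow> 'a list \<Rightarrow> 'a list" where
  "subst_pow \<tau> n = (\<lambda>w. concat (map \<tau> w)) ^^ n"

lemma subst_pow_0 [simp]: "subst_pow \<tau> 0 w = w"
  by (simp add: subst_pow_def)

lemma subst_pow_Suc: "subst_pow \<tau> (Suc n) w = concat (map \<tau> (subst_pow \<tau> n w))"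
  by (simp add: subst_pow_def)

lemma subst_pow_add: "subst_pow \<tau> (m + n) w = subst_pow \<tau> m (subst_pow \<tau> n w)"
  by (simp add: subst_pow_def funpow_add)

lemma subst_pow_Nil [simp]: "subst_pow \<tau> n [] = []"
  by (induction n) (auto simp: subst_pow_Suc)

lemma subst_pow_append [simp]:
  "subst_pow \<tau> n (v @ w) = subst_pow \<tau> n v @ subst_pow \<tau> n w"
  by (induction n) (auto simp: subst_pow_Suc)

lemma subst_pow_concat: "subst_pow \<tau> n (concat ws) = concat (map (subst_pow \<tau> n) ws)"
  by (induction ws) auto

lemma subst_pow_letters: "subst_pow \<tau> n w = concat (map (\<lambda>x. subst_pow \<tau> n [x]) w)"
proof (induction w)
  case (Cons x w)
  then show ?case using subst_pow_append[of \<tau> n "[x]" w] by simp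
qed simp

section \<open>Prefixes and factors of a sequence\<close>

definition seq_prefix :: "(nat \<Rightarrow> 'a) \<Rightarrow> nat \<Rightarrow> 'a list" where
  "seq_prefix X n = map X [0..<n]"

text \<open>Encoded as a suffix of a prefix because iterates map prefixes of the fixed point to
  prefixes.\<close>

definition factor :: "(nat \<Rightarrow> 'a) \<Rightarrow> 'a list \<Rightarrow> bool" where
  "factor X w \<longleftrightarrow> (\<exists>p n. seq_prefix X n = p @ w)"

text \<open>Asking for \<open>s @ u\<close>, not only \<open>s\<close>, means that \<open>s\<close>
  leads from one occurrence of \<open>u\<close> in \<open>X\<close> to the next.\<close>

definition factor_returns :: "(nat \<Rightarrow> 'a) \<Rightarrow> 'a list \<Rightarrow> 'a list set" where
  "factor_returns X u = {s \<in> return_words u. factor X (s @ u)}"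

lemma length_seq_prefix [simp]: "length (seq_prefix X n) = n"
  by (simp add: seq_prefix_def)

lemma nth_seq_prefix [simp]: "i < n \<Longrightarrow> seq_prefix X n ! i = X i"
  by (simp add: seq_prefix_def)

lemma seq_prefix_Suc: "seq_prefix X (Suc n) = seq_prefix X n @ [X n]"
  by (simp add: seq_prefix_def)

lemma seq_prefix_add: "seq_prefix X (m + n) = seq_prefix X m @ map X [m..<m + n]"
  using upt_add_eq_append[of 0 m n] by (simp add: seq_prefix_def)

lemma prefix_seq_prefix:
  "prefix w (seq_prefix X n) \<longleftrightarrow> length w \<le> n \<and> w = seq_prefix X (length w)"
proof
  assume p: "prefix w (seq_prefix X n)"
  then have l: "length w \<le> n" using prefix_length_le by fastforce
  have "w = seq_prefix X (length w)"
  proof (rule nth_equalityI)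
    fix i assume "i < length w"
    then show "w ! i = seq_prefix X (length w) ! i"
      using p l by (auto simp: prefix_def nth_append dest!: arg_cong[where f = "\<lambda>v. v ! i"])
  qed simp
  then show "length w \<le> n \<and> w = seq_prefix X (length w)" using l by simp
next
  assume "length w \<le> n \<and> w = seq_prefix X (length w)"
  then show "prefix w (seq_prefix X n)"
    by (metis le_add_diff_inverse prefixI seq_prefix_add)
qed

lemma factor_seq_prefix [simp]: "factor X (seq_prefix X n)"
  unfolding factor_def by (intro exI[of _ "[]"] exI[of _ n]) simp

lemma factor_middle:
  assumes "factor X (v @ w @ x)" shows "factor X w"
proof -
  obtain p n where "seq_prefix X n = p @ v @ w @ x" using assms by (auto simp: factor_def)
  then have "prefix (p @ v @ w) (seq_prefix X n)" by (simp add: prefix_def)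
  then show ?thesis unfolding factor_def prefix_seq_prefix by (metis append.assoc)
qed

lemma factor_append1: "factor X (v @ w) \<Longrightarrow> factor X v"
  using factor_middle[of X "[]" v w] by simp

lemma factor_nth:
  assumes "factor X w"
  obtains i where "\<And>j. j < length w \<Longrightarrow> w ! j = X (i + j)"
proof -
  obtain p n where e: "seq_prefix X n = p @ w" using assms by (auto simp: factor_def)
  then have n: "n = length p + length w" using length_seq_prefix by (metis length_append)
  have "w ! j = X (length p + j)" if "j < length w" for j
    using arg_cong[OF e, of "\<lambda>v. v ! (length p + j)"] that n by (simp add: nth_append)
  then show ?thesis using that by blast
qed

text \<open>The part of \<open>w @ u\<close> after a factor \<open>s\<close> of the decomposition
  begins with \<open>u\<close>, so \<open>s @ u\<close> occurs in \<open>w @ u\<close>.\<close>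

lemma factor_return_dec:
  assumes "w \<in> return_monoid u" "factor X (w @ u)"
  shows "set (return_dec u w) \<subseteq> factor_returns X u"
proof
  fix s assume s: "s \<in> set (return_dec u w)"
  then obtain rs rs' where rs: "return_dec u w = rs @ s # rs'" by (meson split_list)
  have sub: "set rs' \<subseteq> return_words u" "s \<in> return_words u" using return_dec(1)[OF assms(1)] rs by auto
  have w: "w = concat rs @ s @ concat rs'" using return_dec(2)[OF assms(1)] rs by auto
  have "concat rs' \<in> return_monoid u"
    using sub return_words_subset by (blast intro: return_monoid_concat)
  then obtain q where "concat rs' @ u = u @ q" by (auto simp: return_monoid_def prefix_def)
  then have "w @ u = concat rs @ (s @ u) @ q" using w by simp
  then have "factor X (s @ u)" using assms(2) factor_middle by metis
  then show "s \<in> factor_returns X u" using sub by (simp add: factor_returns_def)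
qed

locale primitive_fixed_point =
  fixes \<tau> :: "'a \<Rightarrow> 'a list" and A :: "'a set" and X :: "nat \<Rightarrow> 'a"
  assumes substitution: "substitution \<tau> A (X 0)" and primitive: "primitive \<tau> A"
    and fixed: "fixed_point \<tau> A (X 0) X" and non_periodic: "non_periodic X"
begin

abbreviation "iter \<equiv> subst_pow \<tau>"
abbreviation "pre \<equiv> seq_prefix X"
text \<open>Determined by \<open>X\<close> alone, hence the same set for all substitutions fixing
  \<open>X\<close>.\<close>

abbreviation "G \<equiv> factor_returns X [X 0]"

section \<open>Growth of the iterates and primitivity\<close>

lemma finA: "finite A" and \<tau>_ne: "x \<in> A \<Longrightarrow> \<tau> x \<noteq> []" and \<tau>_sub: "x \<in> A \<Longrightarrow> set (\<tau> x) \<subseteq> A"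
  and hd_\<tau>: "hd (\<tau> (X 0)) = X 0"
  using substitution by (auto simp: substitution_def)

lemma X_in [simp]: "X n \<in> A"
  using fixed by (auto simp: fixed_point_def)

lemma set_pre: "set (pre n) \<subseteq> A"
  by (auto simp: seq_prefix_def)

lemma set_factor: "factor X w \<Longrightarrow> set w \<subseteq> A"
  unfolding factor_def using set_pre by (metis Un_subset_iff set_append)

lemma set_pow: "set w \<subseteq> A \<Longrightarrow> set (iter n w) \<subseteq> A"
  by (induction n) (use \<tau>_sub in \<open>fastforce simp: subst_pow_Suc\<close>)+

lemma length_\<tau>_ge: "set w \<subseteq> A \<Longrightarrow> length w \<le> length (concat (map \<tau> w))"
proof (induction w)
  case (Cons x w)
  then have "\<tau> x \<noteq> []" using \<tau>_ne by simp
  then have "1 \<le> length (\<tau> x)" by (cases "\<tau> x") auto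
  then show ?case using Cons by simp
qed simp

lemma length_pow_ge: "set w \<subseteq> A \<Longrightarrow> length w \<le> length (iter n w)"
proof (induction n)
  case (Suc n)
  then show ?case using length_\<tau>_ge[OF set_pow[OF Suc.prems, of n]] by (simp add: subst_pow_Suc)
qed simp

lemma length_pow_mono:
  assumes "set w \<subseteq> A" "m \<le> n"
  shows "length (iter m w) \<le> length (iter n w)"
  using length_pow_ge[OF set_pow[OF assms(1), of m], of "n - m"] assms(2)
  by (simp flip: subst_pow_add)

lemma pow_pre: "iter n (pre k) = pre (length (iter n (pre k)))"
proof (induction n)
  case (Suc n)
  define m where "m = length (iter n (pre k))"
  define v where "v = concat (map \<tau> (pre m))"
  have "v ! i = X i" if "i < length v" for i
    using fixed that unfolding fixed_point_def subst_fixes_seq_def v_def seq_prefix_def by simp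
  then have "v = pre (length v)" by (intro nth_equalityI) auto
  moreover have "iter (Suc n) (pre k) = v" using Suc by (simp add: subst_pow_Suc v_def m_def)
  ultimately show ?case by simp
qed simp

lemma factor_pow: "factor X w \<Longrightarrow> factor X (iter n w)"
  unfolding factor_def by (metis pow_pre subst_pow_append)

lemma mat_pow_eq_count:
  assumes "j \<in> A"
  shows "mat_pow A (subst_matrix \<tau>) n i j = count_list (iter n [j]) i"
proof (induction n arbitrary: i)
  case (Suc n)
  have s: "set (iter n [j]) \<subseteq> A" using assms set_pow[of "[j]"] by simp
  have "count_list (iter (Suc n) [j]) i = sum_list (map (\<lambda>k. count_list (\<tau> k) i) (iter n [j]))"
    by (simp add: subst_pow_Suc count_list_concat o_def)
  also have "\<dots> = (\<Sum>k\<in>A. of_nat (count_list (iter n [j]) k) * count_list (\<tau> k) i)"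
    by (rule sum_list_map_count[OF finA s])
  finally show ?case using Suc by (simp add: subst_matrix_def mult.commute)
qed simp

lemma covering_power:
  obtains k where "k \<ge> 1" "\<And>b. b \<in> A \<Longrightarrow> A \<subseteq> set (iter k [b])"
proof -
  obtain k where k: "k \<ge> 1" "\<And>i j. i \<in> A \<Longrightarrow> j \<in> A \<Longrightarrow> mat_pow A (subst_matrix \<tau>) k i j > 0"
    using primitive by (auto simp: primitive_def)
  have "A \<subseteq> set (iter k [b])" if "b \<in> A" for b
    using k(2) that by (auto simp: mat_pow_eq_count) (metis count_list_0_iff less_numeral_extra(3))
  then show ?thesis using that k by blast
qed

lemma pre_1: "pre 1 = [X 0]" "pre (Suc 0) = [X 0]"
  by (auto simp: seq_prefix_def)

lemma pow_X0: "iter n [X 0] = pre (length (iter n [X 0]))"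
  using pow_pre[of n 1] pre_1 by simp

text \<open>A one-letter image would be \<open>X 0\<close> itself, fixed by all iterates;
  primitivity would leave a single letter, and \<open>X\<close> would be constant.\<close>

lemma length_\<tau>_X0: "length (\<tau> (X 0)) \<ge> 2"
proof (rule ccontr)
  assume "\<not> ?thesis"
  moreover have "\<tau> (X 0) \<noteq> []" using \<tau>_ne by simp
  ultimately have e: "\<tau> (X 0) = [X 0]" using hd_\<tau> by (cases "\<tau> (X 0)") (auto simp: Suc_le_eq)
  have p: "iter n [X 0] = [X 0]" for n by (induction n) (auto simp: subst_pow_Suc e)
  obtain k where "A \<subseteq> set (iter k [X 0])" using covering_power X_in by metis
  then have "A \<subseteq> {X 0}" using p by simp
  then have e: "X n = X 0" for n using X_in[of n] by blast
  have "X (n + 1) = X n" for n using e[of "n + 1"] e[of n] by (rule trans[OF _ sym])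
  then have "(1::nat) > 0 \<and> (\<forall>n\<ge>0. X (n + 1) = X n)" by blast
  then have "\<exists>N p. p > 0 \<and> (\<forall>n\<ge>N. X (n + p) = X n)" by (intro exI)
  then have "\<not> Defs.non_periodic X" unfolding non_periodic_def by blast
  then show False using non_periodic by simp
qed

lemma length_pow_X0_Suc: "length (iter n [X 0]) < length (iter (Suc n) [X 0])"
proof -
  obtain v where v: "\<tau> (X 0) = [X 0] @ v" using hd_\<tau> length_\<tau>_X0 by (cases "\<tau> (X 0)") auto
  then have vne: "length v \<ge> 1" using length_\<tau>_X0 by simp
  have "set v \<subseteq> A" using \<tau>_sub[of "X 0"] v by auto
  have "iter (Suc n) [X 0] = iter n (\<tau> (X 0))"
    using subst_pow_add[of \<tau> n 1 "[X 0]"] by (simp add: subst_pow_Suc)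
  then show ?thesis using v vne length_pow_ge[OF \<open>set v \<subseteq> A\<close>, of n]
    by (auto simp del: append_Cons append_Nil)
qed

lemma length_pow_X0: "n < length (iter n [X 0])"
  by (induction n) (use length_pow_X0_Suc in \<open>auto intro: le_less_trans[OF Suc_leI]\<close>)

section \<open>Cutting \<open>X\<close> into the blocks \<open>iter n [X m]\<close>\<close>

definition boundary :: "nat \<Rightarrow> nat \<Rightarrow> nat" where
  "boundary n m = length (iter n (pre m))"

lemma boundary_0 [simp]: "boundary n 0 = 0"
  by (simp add: boundary_def seq_prefix_def)

lemma boundary_Suc: "boundary n (Suc m) = boundary n m + length (iter n [X m])"
  by (simp add: boundary_def seq_prefix_Suc)

lemma boundary_less_Suc: "boundary n m < boundary n (Suc m)"
  using length_pow_ge[of "[X m]" n] X_in[of m] by (auto simp: boundary_Suc)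

lemma boundary_mono: "m \<le> m' \<Longrightarrow> boundary n m \<le> boundary n m'"
  using lift_Suc_mono_le[of "boundary n"] boundary_less_Suc less_imp_le by blast

lemma boundary_locate: obtains m where "boundary n m \<le> i" "i < boundary n (Suc m)"
proof (induction i arbitrary: thesis)
  case 0
  then show ?case using boundary_less_Suc[of n 0] by (metis boundary_0 le0)
next
  case (Suc i)
  obtain m where m: "boundary n m \<le> i" "i < boundary n (Suc m)" using Suc.IH by blast
  show ?case
  proof (cases "Suc i < boundary n (Suc m)")
    case True
    then show ?thesis using m Suc.prems[of m] by simp
  next
    case False
    then have "Suc i = boundary n (Suc m)" using m by simp
    then show ?thesis using Suc.prems[of "Suc m"] boundary_less_Suc[of n "Suc m"] by simp
  qed
qed

text \<open>The image of \<open>pre (m + k)\<close> is a prefix of \<open>X\<close>, and the images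
  of its first \<open>m\<close> letters fill the positions below
  \<open>boundary n m\<close>.\<close>

lemma nth_boundary:
  assumes "i < length (iter n (map X [m..<m + k]))"
  shows "X (boundary n m + i) = iter n (map X [m..<m + k]) ! i"
proof -
  have e: "iter n (pre (m + k)) = iter n (pre m) @ iter n (map X [m..<m + k])"
    by (simp add: seq_prefix_add)
  have "X (boundary n m + i) = iter n (pre (m + k)) ! (boundary n m + i)"
    using assms e pow_pre[of n "m + k"] nth_seq_prefix
    by (metis boundary_def length_append nat_add_left_cancel_less)
  then show ?thesis by (simp add: e boundary_def nth_append)
qed

text \<open>For a covering exponent \<open>k\<close> every block contains \<open>X 0\<close>, and
  the block after the one around \<open>i\<close> ends within two maximal block lengths.\<close>

lemma X0_bounded_gaps: obtains Q where "\<And>i. \<exists>j\<ge>i. j < i + Q \<and> X j = X 0"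
proof -
  obtain k where k: "\<And>b. b \<in> A \<Longrightarrow> A \<subseteq> set (iter k [b])" using covering_power by blast
  define L where "L = Max ((\<lambda>b. length (iter k [b])) ` A)"
  have L: "length (iter k [b]) \<le> L" if "b \<in> A" for b using finA that by (auto simp: L_def)
  have "\<exists>j\<ge>i. j < i + 2 * L \<and> X j = X 0" for i
  proof -
    obtain m where m: "boundary k m \<le> i" "i < boundary k (Suc m)" using boundary_locate .
    have "X 0 \<in> set (iter k [X (Suc m)])" using k X_in by blast
    then obtain x where x: "x < length (iter k [X (Suc m)])" "iter k [X (Suc m)] ! x = X 0"
      by (auto simp: in_set_conv_nth)
    then have "X (boundary k (Suc m) + x) = X 0" using nth_boundary[of x k "Suc m" 1] by simp
    moreover have "boundary k (Suc m) + x < i + 2 * L"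
      using m x(1) L[of "X m"] L[of "X (Suc m)"] by (simp add: boundary_Suc)
    ultimately show ?thesis using m by (intro exI[of _ "boundary k (Suc m) + x"]) auto
  qed
  then show ?thesis using that by blast
qed

text \<open>A return word to \<open>X 0\<close> contains this letter only at its start, so the
  bounded gaps bound its length.\<close>

lemma finite_G: "finite G"
proof -
  obtain Q where Q: "\<And>i. \<exists>j\<ge>i. j < i + Q \<and> X j = X 0" using X0_bounded_gaps by blast
  have "length r \<le> Q" if r: "r \<in> G" for r
  proof (rule ccontr)
    assume l: "\<not> length r \<le> Q"
    have r': "r \<in> return_words [X 0]" "factor X r"
      using r factor_append1 by (auto simp: factor_returns_def)
    then obtain i where i: "\<And>j. j < length r \<Longrightarrow> r ! j = X (i + j)" using factor_nth by blast
    obtain j where j: "Suc i \<le> j" "j < Suc i + Q" "X j = X 0" using Q by blast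
    then have jl: "j - i < length r" "0 < j - i" using l by auto
    then have "r ! (j - i) = X 0" using i[of "j - i"] j by simp
    obtain x where x: "j - i = Suc x" using jl(2) gr0_implies_Suc by blast
    have "tl r ! x = X 0" "x < length (tl r)"
      using jl(1) \<open>r ! (j - i) = X 0\<close> unfolding x by (auto simp: nth_tl)
    then have "X 0 \<in> set (tl r)" by (metis nth_mem)
    then show False using r'(1) by (simp add: return_words_singleton)
  qed
  moreover have "set r \<subseteq> A" if "r \<in> G" for r
    using that set_factor[of "r @ [X 0]"] by (auto simp: factor_returns_def)
  ultimately have "G \<subseteq> {r. set r \<subseteq> A \<and> length r \<le> Q}" by blast
  then show ?thesis using finite_lists_length_le[OF finA] finite_subset by blast
qed

text \<open>Every two-letter factor occurs in \<open>\<tau>\<^sup>k(X\<^sub>0)\<close>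
  for a fixed \<open>k\<close>, so a period of \<open>\<tau>\<^bsup>j+k\<^esup>(X\<^sub>0)\<close>
  shorter than all blocks \<open>\<tau>\<^sup>j(b)\<close> is a period of every \<open>\<tau>\<^sup>j(bc)\<close>, hence of \<open>X\<close>.\<close>
lemma no_short_period:
  obtains k where "\<And>j p N. p > 0 \<Longrightarrow> (\<And>b. b \<in> A \<Longrightarrow> p \<le> length (iter j [b])) \<Longrightarrow>
    length (iter (j + k) [X 0]) \<le> N \<Longrightarrow> \<exists>i. i + p < N \<and> X (i + p) \<noteq> X i"
proof -
  define f where "f m = (X m, X (Suc m))" for m
  have "finite (range f)"
    by (rule finite_subset[of _ "A \<times> A"]) (auto simp: f_def finA)
  \<comment> \<open>For each pair of neighbouring letters one position is chosen; \<open>k\<close>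
    is so large that \<open>iter k [X 0]\<close> covers all chosen pairs.\<close>
  define g where "g y = (SOME m. f m = y)" for y
  have g: "f (g (f m)) = f m" for m unfolding g_def by (metis (mono_tags) someI_ex)
  define k where "k = Suc (Max (g ` range f))"
  have gk: "g (f m) + 2 \<le> length (iter k [X 0])" for m
  proof -
    have "g (f m) \<le> Max (g ` range f)" using \<open>finite (range f)\<close> by (intro Max_ge) auto
    then show ?thesis using length_pow_X0[of k] by (simp add: k_def)
  qed
  show ?thesis
  proof (rule that, rule ccontr)
    fix j p N
    assume p: "p > 0" "\<And>b. b \<in> A \<Longrightarrow> p \<le> length (iter j [b])"
      and N: "length (iter (j + k) [X 0]) \<le> N"
      and "\<not> (\<exists>i. i + p < N \<and> X (i + p) \<noteq> X i)"
    then have per: "X (i + p) = X i" if "i + p < N" for i using that by blast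
    have "X (i + p) = X i" for i
    proof -
      obtain m where m: "boundary j m \<le> i" "i < boundary j (Suc m)" using boundary_locate .
      define q where "q = g (f m)"
      have q: "X q = X m" "X (Suc q) = X (Suc m)" using g[of m] by (auto simp: f_def q_def)
      define v where "v = iter j [X m, X (Suc m)]"
      have lv: "length v = length (iter j [X m]) + length (iter j [X (Suc m)])"
        unfolding v_def using subst_pow_append[of \<tau> j "[X m]" "[X (Suc m)]"] by simp
      have m2: "map X [m..<m + 2] = [X m, X (Suc m)]" "map X [q..<q + 2] = [X m, X (Suc m)]"
        using q by (simp_all add: upt_rec)
      have v1: "X (boundary j m + x) = v ! x" if "x < length v" for x
        using nth_boundary[of x j m 2] that m2 by (simp add: v_def)
      have v2: "X (boundary j q + x) = v ! x" if "x < length v" for x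
        using nth_boundary[of x j q 2] that m2 by (simp add: v_def)
      have bq: "boundary j q + length v \<le> N"
      proof -
        have "boundary j q + length v = boundary j (q + 2)"
          using q by (simp add: boundary_Suc lv)
        also have "\<dots> \<le> boundary j (length (iter k [X 0]))"
          using gk[of m] by (intro boundary_mono) (simp add: q_def)
        also have "\<dots> = length (iter (j + k) [X 0])"
          unfolding boundary_def using pow_X0[of k] by (simp add: subst_pow_add)
        finally show ?thesis using N by simp
      qed
      \<comment> \<open>As \<open>p\<close> is at most the length of the next block,
        \<open>i\<close> and \<open>i + p\<close> both lie in the image of \<open>X m\<close> and
        \<open>X (Suc m)\<close>. This image recurs at \<open>boundary j q\<close>, inside the
        periodic range.\<close>
      define x where "x = i - boundary j m"
      have x: "i = boundary j m + x" "x + p < length v"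
        using m p(2)[of "X (Suc m)"] lv by (auto simp: x_def boundary_Suc)
      have "X (i + p) = v ! (x + p)" using v1[of "x + p"] x by (simp add: add.assoc)
      also have "\<dots> = X (boundary j q + x + p)" using v2[of "x + p"] x by (simp add: add.assoc)
      also have "\<dots> = X (boundary j q + x)" using per x bq by simp
      also have "\<dots> = X i" using v1[of x] v2[of x] x by simp
      finally show ?thesis .
    qed
    then have "\<not> Defs.non_periodic X" unfolding non_periodic_def using p(1) by blast
    then show False using non_periodic by simp
  qed
qed

section \<open>Coding iterates by return words to a prefix\<close>

lemma pow_return_monoid:
  assumes "N \<le> length (iter n [X 0])" "w \<in> return_monoid [X 0]"
  shows "iter n w \<in> return_monoid (pre N)"
proof -
  have "prefix (pre N) (iter n [X 0])"
    using pow_X0[of n] assms(1) prefix_seq_prefix[of "pre N" X "length (iter n [X 0])"] by simp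
  moreover obtain z where "w @ [X 0] = [X 0] @ z"
    using assms(2) unfolding return_monoid_def prefix_def by blast
  \<comment> \<open>Applying \<open>iter n\<close> to the relation for \<open>[X 0]\<close> gives
    the same relation for \<open>iter n [X 0]\<close>, which has \<open>pre N\<close> as a
    prefix.\<close>
  then have "iter n w @ iter n [X 0] = iter n [X 0] @ iter n z" by (metis subst_pow_append)
  then have "iter n w \<in> return_monoid (iter n [X 0])" by (simp add: return_monoid_def)
  ultimately show ?thesis using return_monoid_mono by blast
qed

lemma G_return_monoid: "g \<in> G \<Longrightarrow> g \<in> return_monoid [X 0]"
  using return_words_subset by (auto simp: factor_returns_def)

lemma return_dec_pow_subset:
  assumes "N \<le> length (iter n [X 0])" "g \<in> G"
  shows "set (return_dec (pre N) (iter n g)) \<subseteq> factor_returns X (pre N)"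
proof (rule factor_return_dec)
  show "iter n g \<in> return_monoid (pre N)" using pow_return_monoid[OF assms(1)] G_return_monoid assms(2) .
  have "factor X (g @ [X 0])" using assms(2) by (simp add: factor_returns_def)
  then have "factor X (iter n g @ iter n [X 0])" using factor_pow by fastforce
  moreover obtain z where "iter n [X 0] = pre N @ z"
    using pow_X0[of n] assms(1) prefix_seq_prefix[of "pre N" X "length (iter n [X 0])"]
    by (auto simp: prefix_def)
  ultimately show "factor X (iter n g @ pre N)" by (metis append.assoc factor_append1)
qed

text \<open>Long prefixes of \<open>X\<close> that stop just before \<open>X 0\<close> place any
  given position inside a product of elements of \<open>G\<close>.\<close>

lemma return_cut:
  obtains e where "k \<le> e" "X e = X 0" "pre e \<in> return_monoid [X 0]"
    "set (return_dec [X 0] (pre e)) \<subseteq> G"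
proof -
  obtain Q where "\<And>i. \<exists>e\<ge>i. e < i + Q \<and> X e = X 0" using X0_bounded_gaps by blast
  then obtain e where e: "e \<ge> k" "X e = X 0" by blast
  have w: "pre e \<in> return_monoid [X 0]"
    unfolding return_monoid_singleton
    by (cases e) (auto simp: seq_prefix_def hd_map upt_conv_Cons simp del: upt_Suc)
  have "factor X (pre e @ [X 0])" using e(2) factor_seq_prefix[of X "Suc e"] by (simp add: seq_prefix_Suc)
  then show ?thesis using factor_return_dec[OF w] e w that by blast
qed

text \<open>An occurrence of \<open>s @ pre N\<close> lies in \<open>iter n (pre e) @ pre N\<close>
  for a large \<open>e\<close> with \<open>X e = X 0\<close>. Decomposing \<open>pre e\<close> over
  \<open>G\<close> puts \<open>s\<close> into the coding of some \<open>iter n g\<close>.\<close>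

lemma factor_returns_cover:
  assumes "N \<le> length (iter n [X 0])"
  shows "factor_returns X (pre N) \<subseteq> (\<Union>g\<in>G. set (return_dec (pre N) (iter n g)))"
proof
  fix s assume s: "s \<in> factor_returns X (pre N)"
  then obtain p k where pk: "pre k = p @ s @ pre N" by (auto simp: factor_returns_def factor_def)
  obtain e where e: "k \<le> e" "X e = X 0" and w: "pre e \<in> return_monoid [X 0]"
    and gs: "set (return_dec [X 0] (pre e)) \<subseteq> G" using return_cut .
  have le: "e \<le> length (iter n (pre e))" using length_pow_ge[OF set_pre, of e n] by simp
  have "s \<in> set (return_dec (pre N) (iter n (pre e)))"
  proof -
    have 0: "iter n (pre e) \<in> return_monoid (pre N)" by (rule pow_return_monoid[OF assms w])
    have 1: "s \<in> return_words (pre N)" using s by (simp add: factor_returns_def)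
    have "iter n (pre (Suc e)) = iter n (pre e) @ iter n [X 0]" using e(2) by (simp add: seq_prefix_Suc)
    then have pe: "iter n (pre e) @ iter n [X 0] = pre (length (iter n (pre (Suc e))))"
      using pow_pre[of n "Suc e"] by simp
    obtain z where z: "iter n [X 0] = pre N @ z"
      using pow_X0[of n] assms(1) prefix_seq_prefix[of "pre N" X "length (iter n [X 0])"]
      by (auto simp: prefix_def)
    have p: "prefix (iter n (pre e) @ pre N) (pre (length (iter n (pre (Suc e)))))"
      using z by (simp flip: pe)
    have "prefix (pre k) (pre (length (iter n (pre (Suc e)))))"
      using e(1) le length_pow_ge[OF set_pre, of "Suc e" n] by (simp add: prefix_seq_prefix)
    then have "prefix (pre k) (iter n (pre e) @ pre N)"
      using e(1) le by (intro prefix_length_prefix[OF _ p]) auto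
    then obtain q where "iter n (pre e) @ pre N = pre k @ q" by (auto simp: prefix_def)
    then have 2: "iter n (pre e) @ pre N = p @ s @ pre N @ q" by (simp add: pk)
    have "length (pre k) = length (p @ s @ pre N)" using pk by metis
    then have "length (p @ s) \<le> length (iter n (pre e))" using e(1) le by simp
    with 0 1 2 show ?thesis by (rule occurrence_in_return_dec)
  qed
  also have "iter n (pre e) = concat (map (iter n) (return_dec [X 0] (pre e)))"
    using return_dec(2)[OF w] subst_pow_concat by metis
  also have "return_dec (pre N) \<dots> = concat (map (return_dec (pre N)) (map (iter n) (return_dec [X 0] (pre e))))"
    by (rule return_dec_concat_map) (use gs pow_return_monoid[OF assms] G_return_monoid in auto)
  finally show "s \<in> (\<Union>g\<in>G. set (return_dec (pre N) (iter n g)))" using gs by auto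
qed

text \<open>For a covering exponent \<open>k\<close>, the word \<open>iter (j + k) [b]\<close>
  contains \<open>iter j [c]\<close>. It is also \<open>iter k\<close> of \<open>iter j [b]\<close>,
  hence at most \<open>L\<close> times as long as \<open>iter j [b]\<close>.\<close>

lemma length_pow_ratio:
  obtains L where "\<And>j b c. b \<in> A \<Longrightarrow> c \<in> A \<Longrightarrow> length (iter j [c]) \<le> L * length (iter j [b])"
proof -
  obtain k where k: "\<And>b. b \<in> A \<Longrightarrow> A \<subseteq> set (iter k [b])" using covering_power by blast
  define L where "L = Max ((\<lambda>b. length (iter k [b])) ` A)"
  have L: "length (iter k [b]) \<le> L" if "b \<in> A" for b using finA that by (auto simp: L_def)
  have Lw: "length (iter k w) \<le> L * length w" if "set w \<subseteq> A" for w
    using that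
  proof (induction w)
    case (Cons x w)
    then show ?case using L[of x] subst_pow_append[of \<tau> k "[x]" w] by simp
  qed simp
  show ?thesis
  proof (rule that)
    fix j b c assume bc: "b \<in> A" "c \<in> A"
    obtain v w where "iter k [b] = v @ [c] @ w" using k[OF bc(1)] bc(2) split_list by fastforce
    then have "length (iter j [c]) \<le> length (iter (j + k) [b])"
      by (simp add: subst_pow_add del: append_Cons append_Nil)
    also have "\<dots> = length (iter k (iter j [b]))" by (simp add: add.commute flip: subst_pow_add)
    also have "\<dots> \<le> L * length (iter j [b])" using Lw set_pow[of "[b]"] bc by simp
    finally show "length (iter j [c]) \<le> L * length (iter j [b])" .
  qed
qed

lemma length_pow_le:
  assumes "\<And>c. c \<in> A \<Longrightarrow> length (iter j [c]) \<le> M" "set w \<subseteq> A"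
  shows "length (iter j w) \<le> length w * M"
  using assms(2)
proof (induction w)
  case (Cons x w)
  then show ?case using assms(1)[of x] subst_pow_append[of \<tau> j "[x]" w] by simp
qed simp

text \<open>For the least \<open>n\<close> at which \<open>iter n [X 0]\<close> reaches length
  \<open>N\<close>, return words to \<open>pre N\<close> are longer than the shortest block of a
  level \<open>j\<close> a fixed number of steps below \<open>n\<close>. In turn
  \<open>iter n g\<close> consists of boundedly many blocks of that level, all of comparable
  length.\<close>

lemma bounded_return_dec:
  obtains C N0 where "\<And>N. N \<ge> N0 \<Longrightarrow> \<exists>n. N \<le> length (iter n [X 0]) \<and>
    (\<forall>g\<in>G. length (return_dec (pre N) (iter n g)) \<le> C)"
proof -
  obtain k where k: "\<And>j p N. p > 0 \<Longrightarrow> (\<And>b. b \<in> A \<Longrightarrow> p \<le> length (iter j [b])) \<Longrightarrow>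
    length (iter (j + k) [X 0]) \<le> N \<Longrightarrow> \<exists>i. i + p < N \<and> X (i + p) \<noteq> X i"
    using no_short_period by blast
  obtain L where L: "\<And>j b c. b \<in> A \<Longrightarrow> c \<in> A \<Longrightarrow> length (iter j [c]) \<le> L * length (iter j [b])"
    using length_pow_ratio by blast
  define D where "D = Max ((\<lambda>g. length (iter (Suc k) g)) ` G)"
  have D: "length (iter (Suc k) g) \<le> D" if "g \<in> G" for g using finite_G that by (auto simp: D_def)
  \<comment> \<open>The lower bound on \<open>N\<close> forces \<open>n > k\<close>.
    \<open>D\<close> bounds the number of level \<open>j\<close> blocks in \<open>iter n g\<close>,
    and \<open>L\<close> compares their lengths.\<close>
  show ?thesis
  proof (rule that[of "Suc (length (iter k [X 0]))" "D * L"])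
    fix N assume N: "Suc (length (iter k [X 0])) \<le> N"
    define n where "n = (LEAST n. N \<le> length (iter n [X 0]))"
    have n: "N \<le> length (iter n [X 0])"
      unfolding n_def by (rule LeastI[of _ N]) (use length_pow_X0[of N] in simp)
    have "n > k"
      using n N length_pow_mono[of "[X 0]" n k] by (metis X_in empty_set insert_subset empty_subsetI
        leI le_trans list.simps(15) not_less_eq_eq)
    define j where "j = n - Suc k"
    have nj: "n = j + Suc k" using \<open>n > k\<close> by (simp add: j_def)
    \<comment> \<open>Here \<open>j + k = n - 1\<close>, so minimality of \<open>n\<close> supplies
      the length condition of \<open>no_short_period\<close>.\<close>
    have jk: "length (iter (j + k) [X 0]) \<le> N"
      using not_less_Least[of "j + k" "\<lambda>n. N \<le> length (iter n [X 0])"] nj by (simp add: n_def)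
    \<comment> \<open>A return word no longer than any block would be a forbidden short period of
      \<open>pre N\<close>.\<close>
    have short: "\<exists>b\<in>A. length (iter j [b]) < length s" if s: "s \<in> return_words (pre N)" for s
    proof (rule ccontr)
      assume "\<not> ?thesis"
      then have "\<And>b. b \<in> A \<Longrightarrow> length s \<le> length (iter j [b])" by (meson not_le)
      moreover have "length s > 0" using s by (auto simp: return_words_def)
      ultimately obtain i where i: "i + length s < N" "X (i + length s) \<noteq> X i"
        using k jk by blast
      have "s \<in> return_monoid (pre N)" using s return_words_subset by blast
      from period_of_return_monoid[OF this, of i] i show False by simp
    qed
    have "A \<noteq> {}" using X_in[of 0] by blast
    then obtain b where b: "b \<in> A" "\<And>c. c \<in> A \<Longrightarrow> length (iter j [b]) \<le> length (iter j [c])"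
      using arg_min_if_finite(1)[OF finA, of "\<lambda>b. length (iter j [b])"]
        arg_min_least[OF finA, where f = "\<lambda>b. length (iter j [b])"] by blast
    have "length (return_dec (pre N) (iter n g)) \<le> D * L" if g: "g \<in> G" for g
    proof -
      have m: "iter n g \<in> return_monoid (pre N)" by (rule pow_return_monoid[OF n G_return_monoid[OF g]])
      have "length l * length (iter j [b]) \<le> length (concat l)" if "set l \<subseteq> return_words (pre N)" for l
        using that
      proof (induction l)
        case (Cons s l)
        obtain c where "c \<in> A" "length (iter j [c]) < length s" using short Cons.prems by auto
        then have "length (iter j [b]) \<le> length s" using b(2)[of c] by simp
        then show ?case using Cons by simp
      qed simp
      from this[OF return_dec(1)[OF m]]
      have "length (return_dec (pre N) (iter n g)) * length (iter j [b]) \<le> length (iter n g)"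
        using return_dec(2)[OF m] by simp
      also have "\<dots> = length (iter j (iter (Suc k) g))" by (simp only: nj subst_pow_add)
      also have "\<dots> \<le> length (iter (Suc k) g) * (L * length (iter j [b]))"
        by (rule length_pow_le) (use L b(1) g set_factor[of "g @ [X 0]"] set_pow in
          \<open>auto simp: factor_returns_def\<close>)
      also have "\<dots> \<le> D * (L * length (iter j [b]))" using D[OF g] by (rule mult_le_mono1)
      finally have "length (return_dec (pre N) (iter n g)) * length (iter j [b]) \<le>
        (D * L) * length (iter j [b])" by (simp add: mult.assoc)
      moreover have "length (iter j [b]) > 0" using length_pow_ge[of "[b]" j] b(1) by auto
      ultimately show ?thesis by simp
    qed
    then show "\<exists>n. N \<le> length (iter n [X 0]) \<and>
        (\<forall>g\<in>G. length (return_dec (pre N) (iter n g)) \<le> D * L)" using n by blast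
  qed
qed

end

section \<open>Comparison of eigenvalues\<close>

text \<open>Each appended piece costs at most one, so the error depends on the number of pieces and
  not on their lengths.\<close>

lemma count_return_dec_concat:
  assumes "w \<in> return_monoid [a]" "w \<noteq> []"
  obtains d where "\<bar>d\<bar> \<le> int (length vs)"
    "int (count_list (return_dec [a] (w @ concat vs)) g) =
       int (count_list (return_dec [a] w) g) +
       (\<Sum>v\<leftarrow>vs. int (count_list (return_dec [a] (dropWhile (\<lambda>x. x \<noteq> a) v)) g)) + d"
  using assms
proof (induction vs arbitrary: w thesis)
  case Nil
  then show ?case by simp
next
  case (Cons v vs)
  have wv: "w @ v \<in> return_monoid [a]" "w @ v \<noteq> []"
    using Cons.prems by (auto simp: return_monoid_singleton)
  obtain d where d: "d \<in> {-1..1}"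
    "int (count_list (return_dec [a] (w @ v)) g) = int (count_list (return_dec [a] w) g) +
       int (count_list (return_dec [a] (dropWhile (\<lambda>x. x \<noteq> a) v)) g) + d"
    using count_return_dec_append[OF Cons.prems(2,3)] by blast
  obtain d' where d': "\<bar>d'\<bar> \<le> int (length vs)"
    "int (count_list (return_dec [a] ((w @ v) @ concat vs)) g) =
       int (count_list (return_dec [a] (w @ v)) g) +
       (\<Sum>v\<leftarrow>vs. int (count_list (return_dec [a] (dropWhile (\<lambda>x. x \<noteq> a) v)) g)) + d'"
    using Cons.IH[OF _ wv] by blast
  show ?case using d d' by (intro Cons.prems(1)[of "d + d'"]) auto
qed

section \<open>The substitution induced on return words to the first letter\<close>

context primitive_fixed_point
begin

text \<open>Known as the derived substitution: \<open>iter n\<close> read in the free basis of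
  return words to \<open>X 0\<close>.\<close>

definition return_subst :: "nat \<Rightarrow> 'a list \<Rightarrow> 'a list list" where
  "return_subst n g = return_dec [X 0] (iter n g)"

text \<open>Every \<open>iter n g\<close> with \<open>g\<close> a return word to \<open>X 0\<close>
  lies in the monoid of \<open>pre N\<close>, so images of products decompose factor by factor. For
  \<open>N = 1\<close> this gives the composition law of \<open>return_subst\<close>.\<close>

lemma return_dec_pow:
  assumes "N \<le> length (iter n [X 0])" "w \<in> return_monoid [X 0]"
  shows "return_dec (pre N) (iter n w) =
    concat (map (\<lambda>g. return_dec (pre N) (iter n g)) (return_dec [X 0] w))"
proof -
  have "iter n w = concat (map (iter n) (return_dec [X 0] w))"
    using return_dec(2)[OF assms(2)] subst_pow_concat by metis
  moreover have "set (map (iter n) (return_dec [X 0] w)) \<subseteq> return_monoid (pre N)"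
    using return_dec(1)[OF assms(2)] return_words_subset[of "[X 0]"] pow_return_monoid[OF assms(1)]
    by auto
  ultimately show ?thesis
    using return_dec_concat_map[of "map (iter n) (return_dec [X 0] w)" "pre N"] by (simp add: o_def)
qed

lemma pow_return_monoid_letter: "w \<in> return_monoid [X 0] \<Longrightarrow> iter n w \<in> return_monoid [X 0]"
  using pow_return_monoid[of 1 n w] length_pow_X0[of n] pre_1 by simp

lemma return_subst_subset: "g \<in> G \<Longrightarrow> set (return_subst n g) \<subseteq> G"
  using return_dec_pow_subset[of 1 n g] length_pow_X0[of n] pre_1 by (simp add: return_subst_def)

lemma return_subst_0: "g \<in> G \<Longrightarrow> return_subst 0 g = [g]"
  by (simp add: return_subst_def factor_returns_def return_dec_return_word)

lemma return_subst_add: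
  assumes "g \<in> G"
  shows "return_subst (m + n) g = concat (map (return_subst m) (return_subst n g))"
  using return_dec_pow[of 1 m "iter n g"] length_pow_X0[of m] pre_1
    pow_return_monoid_letter[OF G_return_monoid[OF assms]]
  by (simp add: return_subst_def[abs_def] subst_pow_add)

text \<open>The left side is coordinate \<open>g\<close> of the k-th matrix power applied to
  \<open>x\<close>, as \<open>return_subst (p * k)\<close> is the k-th iterate of
  \<open>return_subst p\<close>.\<close>

lemma return_subst_eigenvector:
  fixes x :: "'a list \<Rightarrow> complex"
  assumes x: "\<And>i. i \<in> G \<Longrightarrow>
      (\<Sum>j\<in>G. of_nat (subst_matrix (return_subst p) i j) * x j) = z * x i"
    and g: "g \<in> G"
  shows "(\<Sum>h\<in>G. x h * of_nat (count_list (return_subst (p * k) h) g)) = z ^ k * x g"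
proof (induction k)
  case 0
  have "(\<Sum>h\<in>G. x h * of_nat (count_list (return_subst (p * 0) h) g)) =
      (\<Sum>h\<in>G. if h = g then x h else 0)"
    by (rule sum.cong) (auto simp: return_subst_0)
  then show ?case using g finite_G by simp
next
  case (Suc k)
  have "(\<Sum>h\<in>G. x h * of_nat (count_list (return_subst (p * Suc k) h) g)) =
    (\<Sum>h\<in>G. x h * sum_list (map (\<lambda>i. of_nat (count_list (return_subst (p * k) i) g)) (return_subst p h)))"
  proof (rule sum.cong)
    fix h assume "h \<in> G"
    then have "return_subst (p * Suc k) h = concat (map (return_subst (p * k)) (return_subst p h))"
      using return_subst_add[of h "p * k" p] by (simp add: add.commute)
    then show "x h * of_nat (count_list (return_subst (p * Suc k) h) g) =
      x h * sum_list (map (\<lambda>i. of_nat (count_list (return_subst (p * k) i) g)) (return_subst p h))"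
      by (simp only: of_nat_count_list_concat_map)
  qed simp
  also have "\<dots> = z * (\<Sum>h\<in>G. x h * of_nat (count_list (return_subst (p * k) h) g))"
    by (rule right_eigenvector_pairing[OF finite_G return_subst_subset x])
  finally show ?case using Suc by (simp add: mult.assoc)
qed

lemma letters_cover: "A \<subseteq> (\<Union>g\<in>G. set g)"
proof
  fix b assume "b \<in> A"
  obtain k where "A \<subseteq> set (iter k [X 0])" using covering_power X_in by metis
  then have "b \<in> set (pre (length (iter k [X 0])))" using \<open>b \<in> A\<close> pow_X0[of k] by auto
  then obtain j where j: "X j = b" by (auto simp: seq_prefix_def)
  obtain e where e: "Suc j \<le> e" and w: "pre e \<in> return_monoid [X 0]"
    and gs: "set (return_dec [X 0] (pre e)) \<subseteq> G" using return_cut .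
  have "b \<in> set (pre e)" using e j by (auto simp: seq_prefix_def)
  also have "pre e = concat (return_dec [X 0] (pre e))" using return_dec(2)[OF w] by simp
  finally show "b \<in> (\<Union>g\<in>G. set g)" using gs by auto
qed

text \<open>In \<open>\<tau>\<^sup>n(h)\<close> the occurrences of a return word \<open>g\<close> are counted letter
  by letter up to a bounded
  error; a vector \<open>x\<close> killed by letter counts therefore has an orbit with finitely many values.\<close>
lemma return_subst_letter_counts:
  assumes x: "\<And>i. i \<in> G \<Longrightarrow>
      (\<Sum>j\<in>G. of_nat (subst_matrix (return_subst p) i j) * x j) = z * x i"
    and x0: "\<exists>g\<in>G. x g \<noteq> 0" and z: "z \<noteq> 0" "\<not> root_of_unity z"
  shows "\<exists>f :: 'a \<Rightarrow> complex. (\<Sum>h\<in>G. x h * sum_list (map f h)) \<noteq> 0"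
proof (rule ccontr)
  assume "\<not> ?thesis"
  then have zero: "(\<Sum>h\<in>G. x h * sum_list (map f h)) = 0" for f :: "'a \<Rightarrow> complex" by blast
  obtain g where g: "g \<in> G" "x g \<noteq> 0" using x0 by blast
  define D where "D = int (Max (length ` G))"
  have D: "int (length h) \<le> D" if "h \<in> G" for h using finite_G that by (auto simp: D_def)
  \<comment> \<open>The letters of \<open>iter n [b]\<close> before its first \<open>X 0\<close> are
    dropped since they finish a return word begun earlier; the count left depends on
    \<open>b\<close> alone.\<close>
  define c where "c n b = int (count_list (return_dec [X 0] (dropWhile (\<lambda>x. x \<noteq> X 0) (iter n [b]))) g)"
    for n b
  define d where "d n h = int (count_list (return_subst n h) g) - sum_list (map (c n) h)" for n h
  have d: "\<bar>d n h\<bar> \<le> D" if h: "h \<in> G" for n h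
  proof -
    obtain h' where h': "h = X 0 # h'"
      using h unfolding factor_returns_def return_words_singleton by (cases h) auto
    define w where "w = iter n [X 0]"
    have w: "w \<in> return_monoid [X 0]" "w \<noteq> []"
      using pow_return_monoid_letter[of "[X 0]" n] length_pow_X0[of n]
      by (auto simp: w_def return_monoid_singleton)
    have "hd w = X 0" using w by (simp add: return_monoid_singleton)
    then have dw: "dropWhile (\<lambda>x. x \<noteq> X 0) w = w" using w(2) by (cases w) auto
    define vs where "vs = map (\<lambda>b. iter n [b]) h'"
    obtain e where e: "\<bar>e\<bar> \<le> int (length vs)"
      "int (count_list (return_dec [X 0] (w @ concat vs)) g) =
         int (count_list (return_dec [X 0] w) g) +
         (\<Sum>v\<leftarrow>vs. int (count_list (return_dec [X 0] (dropWhile (\<lambda>x. x \<noteq> X 0) v)) g)) + e"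
      using count_return_dec_concat[OF w] by blast
    have "iter n h = w @ concat vs"
      using subst_pow_letters[of \<tau> n h] by (simp add: h' w_def vs_def)
    moreover have "c n (X 0) = int (count_list (return_dec [X 0] w) g)"
      using dw by (simp add: c_def w_def)
    moreover have "(\<Sum>v\<leftarrow>vs. int (count_list (return_dec [X 0] (dropWhile (\<lambda>x. x \<noteq> X 0) v)) g)) =
        sum_list (map (c n) h')"
      by (simp add: vs_def c_def[abs_def] o_def)
    ultimately show ?thesis using e D[OF h] by (simp add: d_def return_subst_def h' vs_def)
  qed
  \<comment> \<open>Error vectors are integral, bounded by \<open>D\<close> and restricted to the
    finite set \<open>G\<close>, so there are finitely many.\<close>
  define S where "S = (\<lambda>e. \<Sum>h\<in>G. x h * complex_of_int (e h)) ` (G \<rightarrow>\<^sub>E {-D..D})"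
  have "finite S" unfolding S_def by (intro finite_imageI finite_PiE) (auto simp: finite_G)
  moreover have "z ^ k * x g \<in> S" for k
  proof -
    define n where "n = p * k"
    have "z ^ k * x g = (\<Sum>h\<in>G. x h * of_nat (count_list (return_subst n h) g))"
      unfolding n_def by (rule return_subst_eigenvector[OF x g(1), symmetric])
    also have "\<dots> = (\<Sum>h\<in>G. x h * sum_list (map (\<lambda>b. of_int (c n b)) h) + x h * of_int (d n h))"
    proof (rule sum.cong)
      fix h assume h: "h \<in> G"
      have "complex_of_nat (count_list (return_subst n h) g) = of_int (sum_list (map (c n) h) + d n h)"
        by (simp add: d_def)
      moreover have "complex_of_int (sum_list (map (c n) h)) = sum_list (map (\<lambda>b. of_int (c n b)) h)"
        by (induction h) auto
      ultimately show "x h * of_nat (count_list (return_subst n h) g) =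
          x h * sum_list (map (\<lambda>b. of_int (c n b)) h) + x h * of_int (d n h)"
        by (simp add: distrib_left)
    qed simp
    also have "\<dots> = (\<Sum>h\<in>G. x h * of_int (d n h))" using zero by (simp add: sum.distrib)
    also have "\<dots> = (\<Sum>h\<in>G. x h * of_int (restrict (d n) G h))" by (rule sum.cong) auto
    also have "\<dots> \<in> S" unfolding S_def
      by (rule imageI) (use d[of _ n] in \<open>auto simp: abs_le_iff minus_le_iff\<close>)
    finally show ?thesis .
  qed
  ultimately show False using power_orbit_finite g(2) z by blast
qed

text \<open>Spelling return words in letters is an intertwining with the identity as
  \<open>\<kappa>\<close>. Pulling goes from \<open>A\<close> to \<open>G\<close>; the converse
  needs an eigenvector on \<open>G\<close> to be detected by letter counts.\<close>

lemma eigenvalue_letters_iff: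
  assumes z: "z \<noteq> 0" "\<not> root_of_unity z"
  shows "eigenvalue_on A (mat_pow A (subst_matrix \<tau>) p) z \<longleftrightarrow>
    eigenvalue_on G (subst_matrix (return_subst p)) z"
proof -
  interpret I: intertwined G A "return_subst p" "\<lambda>b. iter p [b]" "\<lambda>g. g"
  proof
    fix g assume g: "g \<in> G"
    show "set (return_subst p g) \<subseteq> G" by (rule return_subst_subset[OF g])
    show "set g \<subseteq> A" using g set_factor[of "g @ [X 0]"] by (auto simp: factor_returns_def)
    have "concat (return_subst p g) = iter p g"
      unfolding return_subst_def by (rule return_dec(2)[OF pow_return_monoid_letter[OF G_return_monoid[OF g]]])
    then show "concat (map (\<lambda>b. iter p [b]) g) = concat (map (\<lambda>g. g) (return_subst p g))"
      using subst_pow_letters[of \<tau> p g] by simp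
  next
    fix b assume "b \<in> A"
    then show "set (iter p [b]) \<subseteq> A" using set_pow[of "[b]"] by simp
  qed (use finite_G finA letters_cover in auto)
  have "eigenvalue_on A (mat_pow A (subst_matrix \<tau>) p) z \<longleftrightarrow>
      eigenvalue_on A (subst_matrix (\<lambda>b. iter p [b])) z"
    by (rule eigenvalue_on_cong) (simp add: mat_pow_eq_count subst_matrix_def)
  also have "\<dots> \<longleftrightarrow> eigenvalue_on G (subst_matrix (return_subst p)) z"
  proof
    assume "eigenvalue_on G (subst_matrix (return_subst p)) z"
    then obtain x where x0: "\<exists>g\<in>G. x g \<noteq> 0" and
      x: "\<And>i. i \<in> G \<Longrightarrow> (\<Sum>j\<in>G. of_nat (subst_matrix (return_subst p) i j) * x j) = z * x i"
      by (auto simp: eigenvalue_on_def)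
    obtain f :: "'a \<Rightarrow> complex" where "(\<Sum>h\<in>G. x h * sum_list (map f h)) \<noteq> 0"
      using return_subst_letter_counts[OF x x0 z] by blast
    then show "eigenvalue_on A (subst_matrix (\<lambda>b. iter p [b])) z"
      using I.eigenvalue_push[of x z f] x by blast
  qed (rule I.eigenvalue_pull[OF z])
  finally show ?thesis .
qed

text \<open>Cutting \<open>\<phi> s\<close> into return words to \<open>pre N\<close> is intertwined
  with \<open>return_subst (n' - n)\<close>, because both sides decompose
  \<open>iter n' g = iter n (iter (n' - n) g)\<close>. The resulting matrix does not mention
  \<open>\<tau>\<close>, which makes two substitutions comparable.\<close>

lemma eigenvalue_derived_iff:
  assumes N: "0 < N" "N \<le> length (iter n [X 0])" and N': "N \<le> N'" "N' \<le> length (iter n' [X 0])"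
    and n: "n < n'"
    and \<phi>: "\<And>s. s \<in> factor_returns X (pre N) \<Longrightarrow> \<phi> s \<in> factor_returns X (pre N')"
    and \<phi>_dec: "\<And>g. g \<in> G \<Longrightarrow>
      map \<phi> (return_dec (pre N) (iter n g)) = return_dec (pre N') (iter n' g)"
    and z: "z \<noteq> 0" "\<not> root_of_unity z"
  shows "eigenvalue_on A (mat_pow A (subst_matrix \<tau>) (n' - n)) z \<longleftrightarrow>
    eigenvalue_on (factor_returns X (pre N)) (subst_matrix (\<lambda>s. return_dec (pre N) (\<phi> s))) z"
proof -
  define p where "p = n' - n"
  define \<kappa> where "\<kappa> g = return_dec (pre N) (iter n g)" for g
  define R where "R = factor_returns X (pre N)"
  define \<pi> where "\<pi> s = return_dec (pre N) (\<phi> s)" for s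
  have pre_le: "prefix (pre N) (pre N')" using N'(1) by (simp add: prefix_seq_prefix)
  then have mono: "return_monoid (pre N') \<subseteq> return_monoid (pre N)" by (rule return_monoid_mono)
  interpret I: intertwined G R "return_subst p" \<pi> \<kappa>
  proof
    show "finite G" by (rule finite_G)
    show cover: "R \<subseteq> (\<Union>g\<in>G. set (\<kappa> g))" unfolding R_def \<kappa>_def
      by (rule factor_returns_cover[OF N(2)])
    show "finite R" by (rule finite_subset[OF cover]) (simp add: finite_G)
  next
    fix g assume g: "g \<in> G"
    show "set (return_subst p g) \<subseteq> G" by (rule return_subst_subset[OF g])
    show "set (\<kappa> g) \<subseteq> R" unfolding R_def \<kappa>_def by (rule return_dec_pow_subset[OF N(2) g])
    have w: "iter n' g \<in> return_monoid (pre N')" by (rule pow_return_monoid[OF N'(2) G_return_monoid[OF g]])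
    have "concat (map \<pi> (\<kappa> g)) = concat (map (return_dec (pre N)) (map \<phi> (\<kappa> g)))"
      by (simp add: \<pi>_def[abs_def] o_def)
    also have "\<dots> = concat (map (return_dec (pre N)) (return_dec (pre N') (iter n' g)))"
      using \<phi>_dec[OF g] by (simp add: \<kappa>_def)
    also have "\<dots> = return_dec (pre N) (concat (return_dec (pre N') (iter n' g)))"
      using return_dec(1)[OF w] return_words_subset mono by (blast intro: return_dec_concat_map[symmetric])
    also have "\<dots> = return_dec (pre N) (iter n (iter p g))"
      using return_dec(2)[OF w] n by (simp add: p_def flip: subst_pow_add)
    also have "\<dots> = concat (map \<kappa> (return_subst p g))"
      using return_dec_pow[OF N(2) pow_return_monoid_letter[OF G_return_monoid[OF g], of p]]
      by (simp add: \<kappa>_def[abs_def] return_subst_def)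
    finally show "concat (map \<pi> (\<kappa> g)) = concat (map \<kappa> (return_subst p g))" .
  next
    fix s assume "s \<in> R"
    then have s: "\<phi> s \<in> return_words (pre N')" "factor X (\<phi> s @ pre N')"
      using \<phi> by (auto simp: R_def factor_returns_def)
    have "factor X (\<phi> s @ pre N)" using s(2) pre_le
      by (auto simp: prefix_def) (metis append.assoc factor_append1)
    moreover have "\<phi> s \<in> return_monoid (pre N)" using s(1) return_words_subset mono by blast
    ultimately show "set (\<pi> s) \<subseteq> R" unfolding \<pi>_def R_def by (intro factor_return_dec)
  qed
  have "eigenvalue_on G (subst_matrix (return_subst p)) z \<longleftrightarrow> eigenvalue_on R (subst_matrix \<pi>) z"
  proof
    assume "eigenvalue_on G (subst_matrix (return_subst p)) z"
    then obtain x g where g: "g \<in> G" "x g \<noteq> 0" and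
      x: "\<And>i. i \<in> G \<Longrightarrow> (\<Sum>j\<in>G. of_nat (subst_matrix (return_subst p) i j) * x j) = z * x i"
      by (auto simp: eigenvalue_on_def)
    \<comment> \<open>\<open>p * n\<close> is a multiple of \<open>p\<close> not below
      \<open>n\<close>. Counting \<open>g\<close> after \<open>p * n - n\<close> further iterations
      thus detects \<open>x\<close>, with the non-zero value \<open>z ^ n * x g\<close>.\<close>
    have "1 * n \<le> p * n" using n by (intro mult_le_mono1) (simp add: p_def)
    then have pn: "p * n = (p * n - n) + n" by simp
    define f where "f s = complex_of_nat (count_list (return_subst (p * n - n) s) g)" for s
    have "sum_list (map f (\<kappa> h)) = of_nat (count_list (return_subst (p * n) h) g)" if h: "h \<in> G" for h
    proof -
      have w: "iter n h \<in> return_monoid (pre N)" by (rule pow_return_monoid[OF N(2) G_return_monoid[OF h]])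
      have "prefix [X 0] (pre N)" using N(1) pre_1(1) prefix_seq_prefix[of "pre 1" X N] by simp
      then have "return_monoid (pre N) \<subseteq> return_monoid [X 0]" by (rule return_monoid_mono)
      then have "set (\<kappa> h) \<subseteq> return_monoid [X 0]"
        using return_dec(1)[OF w] return_words_subset[of "pre N"] unfolding \<kappa>_def by blast
      then have sub: "set (map (iter (p * n - n)) (\<kappa> h)) \<subseteq> return_monoid [X 0]"
        using pow_return_monoid_letter by auto
      have "iter (p * n) h = iter (p * n - n) (iter n h)" by (subst pn) (rule subst_pow_add)
      also have "\<dots> = concat (map (iter (p * n - n)) (\<kappa> h))"
        using return_dec(2)[OF w] unfolding \<kappa>_def by (metis subst_pow_concat)
      finally have "return_subst (p * n) h = concat (map (return_subst (p * n - n)) (\<kappa> h))"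
        using return_dec_concat_map[OF sub] by (simp add: return_subst_def[abs_def] o_def)
      then show ?thesis by (simp add: f_def[abs_def] of_nat_count_list_concat_map)
    qed
    then have "(\<Sum>h\<in>G. x h * sum_list (map f (\<kappa> h))) = z ^ n * x g"
      using return_subst_eigenvector[OF x g(1), of n] by simp
    then show "eigenvalue_on R (subst_matrix \<pi>) z"
      using I.eigenvalue_push[OF x, of f] g(2) z(1) by simp
  qed (rule I.eigenvalue_pull[OF z])
  then show ?thesis using eigenvalue_letters_iff[OF z, of p]
    by (simp add: p_def R_def \<pi>_def[abs_def])
qed

end

text \<open>Injective labels from one finite set turn both codings into elements of a finite set, so
  infinitely many \<open>N\<close> share them. One labelling serves both codings, hence so does one
  \<open>\<phi>\<close>.\<close>

lemma return_coding_pigeonhole: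
  fixes X :: "nat \<Rightarrow> 'a"
  defines "G \<equiv> factor_returns X [X 0]" and "R \<equiv> \<lambda>N. factor_returns X (seq_prefix X N)"
  assumes finG: "finite G"
    and cover: "\<And>N. N \<ge> N0 \<Longrightarrow> R N = (\<Union>g\<in>G. set (\<kappa> N g))"
    and cover': "\<And>N. N \<ge> N0 \<Longrightarrow> R N = (\<Union>g\<in>G. set (\<kappa>' N g))"
    and bound: "\<And>N g. N \<ge> N0 \<Longrightarrow> g \<in> G \<Longrightarrow> length (\<kappa> N g) \<le> C \<and> length (\<kappa>' N g) \<le> C"
  obtains N where "N \<ge> N0" "\<forall>M. \<exists>N' \<phi>. N' \<ge> N0 \<and> N' > M \<and> (\<forall>s\<in>R N. \<phi> s \<in> R N') \<and>
    (\<forall>g\<in>G. map \<phi> (\<kappa> N g) = \<kappa> N' g \<and> map \<phi> (\<kappa>' N g) = \<kappa>' N' g)"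
proof -
  have "\<exists>e. inj_on e (R N) \<and> e ` R N \<subseteq> {..<card G * C}" if N: "N \<ge> N0" for N
  proof -
    have fin: "finite (R N)" using cover[OF N] finG by simp
    have "card (R N) \<le> (\<Sum>g\<in>G. card (set (\<kappa> N g)))" unfolding cover[OF N] by (rule card_UN_le[OF finG])
    also have "\<dots> \<le> card G * C"
      using bound[OF N] card_length le_trans by (intro sum_bounded_above[of G _ C, simplified]) blast
    finally have "card (R N) \<le> card G * C" .
    moreover obtain e where "bij_betw e (R N) {0..<card (R N)}"
      using ex_bij_betw_finite_nat[OF fin] by blast
    ultimately show ?thesis by (intro exI[of _ e]) (auto simp: bij_betw_def)
  qed
  then obtain e where inj: "\<And>N. N \<ge> N0 \<Longrightarrow> inj_on (e N) (R N)"
    and img: "\<And>N. N \<ge> N0 \<Longrightarrow> e N ` R N \<subseteq> {..<card G * C}" by metis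
  define L where "L = {l. set l \<subseteq> {..<card G * C} \<and> length l \<le> C}"
  define code where "code N = (restrict (\<lambda>g. map (e N) (\<kappa> N g)) G, restrict (\<lambda>g. map (e N) (\<kappa>' N g)) G)"
    for N
  have "map (e N) (\<kappa> N g) \<in> L \<and> map (e N) (\<kappa>' N g) \<in> L" if "N \<ge> N0" "g \<in> G" for N g
    using img[OF that(1)] bound[OF that] cover[OF that(1)] cover'[OF that(1)] that(2)
    unfolding L_def by fastforce
  then have "code ` {N0..} \<subseteq> (G \<rightarrow>\<^sub>E L) \<times> (G \<rightarrow>\<^sub>E L)" unfolding code_def
    by auto
  moreover have "finite L" unfolding L_def by (intro finite_lists_length_le) simp
  then have "finite ((G \<rightarrow>\<^sub>E L) \<times> (G \<rightarrow>\<^sub>E L))" using finG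
    by (intro finite_cartesian_product finite_PiE)
  ultimately have "finite (code ` {N0..})" by (rule finite_subset)
  then obtain N where N: "N \<in> {N0..}" "infinite {N' \<in> {N0..}. code N' = code N}"
    using pigeonhole_infinite[OF infinite_Ici] by blast
  show ?thesis
  proof (rule that[OF _ allI])
    show "N \<ge> N0" using N(1) by simp
    fix M
    obtain N' where N': "N' > M" "N' \<ge> N0" "code N' = code N"
      using N(2) unfolding infinite_nat_iff_unbounded by blast
    have eq: "map (e N) (\<kappa> N g) = map (e N') (\<kappa> N' g)" "map (e N) (\<kappa>' N g) = map (e N') (\<kappa>' N' g)"
      if "g \<in> G" for g
      using N'(3) that unfolding code_def by (metis (no_types, lifting) prod.inject restrict_apply')+
    \<comment> \<open>\<open>\<phi>\<close> matches return words carrying the same label.\<close>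
    define \<phi> where "\<phi> s = inv_into (R N') (e N') (e N s)" for s
    have map_inv: "map (inv_into (R N') (e N')) (map (e N') l) = l" if "set l \<subseteq> R N'" for l
      using that inj[OF N'(2)] by (induction l) auto
    have "map \<phi> (\<kappa> N g) = \<kappa> N' g \<and> map \<phi> (\<kappa>' N g) = \<kappa>' N' g" if g: "g \<in> G"
      for g
    proof -
      have "map \<phi> l = map (inv_into (R N') (e N')) (map (e N) l)" for l by (simp add: \<phi>_def)
      moreover have "set (\<kappa> N' g) \<subseteq> R N'" using cover[OF N'(2)] g by blast
      moreover have "set (\<kappa>' N' g) \<subseteq> R N'" using cover'[OF N'(2)] g by blast
      ultimately show ?thesis using eq[OF g] map_inv by metis
    qed
    moreover have "\<phi> s \<in> R N'" if s: "s \<in> R N" for s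
    proof -
      obtain g where g: "g \<in> G" "s \<in> set (\<kappa> N g)" using s cover[OF \<open>N \<ge> N0\<close>] by blast
      then have "e N s \<in> set (map (e N') (\<kappa> N' g))" using eq(1)[OF g(1)] by (metis image_eqI list.set_map)
      then have "e N s \<in> e N' ` R N'" using cover[OF N'(2)] g(1) by auto
      then show ?thesis unfolding \<phi>_def by (rule inv_into_into)
    qed
    ultimately show "\<exists>N' \<phi>. N' \<ge> N0 \<and> N' > M \<and> (\<forall>s\<in>R N. \<phi> s \<in> R N') \<and>
        (\<forall>g\<in>G. map \<phi> (\<kappa> N g) = \<kappa> N' g \<and> map \<phi> (\<kappa>' N g) = \<kappa>' N' g)"
      using N'(1,2) by blast
  qed
qed

section \<open>Two primitive substitutions with a common non-periodic fixed point\<close>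

theorem theorem14:
  fixes \<tau> \<sigma> :: "'a \<Rightarrow> 'a list" and A B :: "'a set" and a b :: 'a and X :: "nat \<Rightarrow> 'a"
  assumes "substitution \<tau> A a" and "substitution \<sigma> B b"
    and "primitive \<tau> A" and "primitive \<sigma> B"
    and "fixed_point \<tau> A a X" and "fixed_point \<sigma> B b X"
    and "non_periodic X"
  shows "\<exists>i j. i > 0 \<and> j > 0 \<and>
    (\<forall>z. z \<noteq> 0 \<and> \<not> root_of_unity z \<longrightarrow>
       (eigenvalue_on A (mat_pow A (subst_matrix \<tau>) i) z \<longleftrightarrow>
        eigenvalue_on B (mat_pow B (subst_matrix \<sigma>) j) z))"
proof -
  have "a = X 0" "b = X 0" using assms(5,6) by (auto simp: fixed_point_def)
  then interpret T: primitive_fixed_point \<tau> A X + S: primitive_fixed_point \<sigma> B X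
    using assms by unfold_locales auto
  define G where "G = factor_returns X [X 0]"
  define R where "R N = factor_returns X (seq_prefix X N)" for N
  define iT where "iT = subst_pow \<tau>"
  define iS where "iS = subst_pow \<sigma>"
  define \<kappa> where "\<kappa> N n g = return_dec (seq_prefix X N) (iT n g)" for N n g
  define \<kappa>' where "\<kappa>' N m g = return_dec (seq_prefix X N) (iS m g)" for N m g
  obtain C N1 where "\<And>N. N \<ge> N1 \<Longrightarrow> \<exists>n. N \<le> length (iT n [X 0]) \<and> (\<forall>g\<in>G. length (\<kappa> N n g) \<le> C)"
    using T.bounded_return_dec unfolding G_def \<kappa>_def iT_def by metis
  then obtain n where n: "\<And>N. N \<ge> N1 \<Longrightarrow> N \<le> length (iT (n N) [X 0])"
    "\<And>N g. N \<ge> N1 \<Longrightarrow> g \<in> G \<Longrightarrow> length (\<kappa> N (n N) g) \<le> C" by metis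
  obtain C' N2 where "\<And>N. N \<ge> N2 \<Longrightarrow> \<exists>m. N \<le> length (iS m [X 0]) \<and> (\<forall>g\<in>G. length (\<kappa>' N m g) \<le> C')"
    using S.bounded_return_dec unfolding G_def \<kappa>'_def iS_def by metis
  then obtain m where m: "\<And>N. N \<ge> N2 \<Longrightarrow> N \<le> length (iS (m N) [X 0])"
    "\<And>N g. N \<ge> N2 \<Longrightarrow> g \<in> G \<Longrightarrow> length (\<kappa>' N (m N) g) \<le> C'" by metis
  \<comment> \<open>\<open>Suc\<close> makes all prefixes considered non-empty.\<close>
  define N0 where "N0 = Suc (max N1 N2)"
  have cover: "R N = (\<Union>g\<in>G. set (\<kappa> N (n N) g))" if "N \<ge> N0" for N
    using T.factor_returns_cover[of N "n N"] T.return_dec_pow_subset[of N "n N"] n(1)[of N] that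
    unfolding R_def G_def \<kappa>_def iT_def N0_def by auto
  have cover': "R N = (\<Union>g\<in>G. set (\<kappa>' N (m N) g))" if "N \<ge> N0" for N
    using S.factor_returns_cover[of N "m N"] S.return_dec_pow_subset[of N "m N"] m(1)[of N] that
    unfolding R_def G_def \<kappa>'_def iS_def N0_def by auto
  have bound: "length (\<kappa> N (n N) g) \<le> max C C' \<and> length (\<kappa>' N (m N) g) \<le> max C C'"
    if "N \<ge> N0" "g \<in> G" for N g
    using n(2)[of N g] m(2)[of N g] that
    by (auto simp: N0_def intro: max.coboundedI1 max.coboundedI2)
  have finG: "finite G" unfolding G_def by (rule T.finite_G)
  obtain N where N: "N \<ge> N0" and ex: "\<forall>M. \<exists>N' \<phi>. N' \<ge> N0 \<and> N' > M \<and> (\<forall>s\<in>R N. \<phi> s \<in> R N') \<and>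
    (\<forall>g\<in>G. map \<phi> (\<kappa> N (n N) g) = \<kappa> N' (n N') g \<and> map \<phi> (\<kappa>' N (m N) g) = \<kappa>' N' (m N') g)"
    by (rule return_coding_pigeonhole[of X N0 "\<lambda>N. \<kappa> N (n N)" "\<lambda>N. \<kappa>' N (m N)" "max C C'",
        folded G_def R_def, OF finG cover cover' bound])
  \<comment> \<open>A prefix longer than both iterates attached to \<open>N\<close> requires larger
    exponents, so both differences of exponents are positive.\<close>
  define M where "M = N + length (iT (n N) [X 0]) + length (iS (m N) [X 0])"
  obtain N' \<phi> where N': "N' \<ge> N0" "N' > M" and \<phi>: "\<And>s. s \<in> R N \<Longrightarrow> \<phi> s \<in> R N'"
    and \<phi>\<kappa>: "\<And>g. g \<in> G \<Longrightarrow> map \<phi> (\<kappa> N (n N) g) = \<kappa> N' (n N') g"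
    and \<phi>\<kappa>': "\<And>g. g \<in> G \<Longrightarrow> map \<phi> (\<kappa>' N (m N) g) = \<kappa>' N' (m N') g"
    using ex by blast
  have le: "N \<le> length (iT (n N) [X 0])" "N' \<le> length (iT (n N') [X 0])"
    "N \<le> length (iS (m N) [X 0])" "N' \<le> length (iS (m N') [X 0])"
    using n(1) m(1) N N'(1) by (auto simp: N0_def)
  have nn: "n N < n N'"
    using T.length_pow_mono[of "[X 0]" "n N'" "n N"] le(2) N'(2)
    by (intro not_le_imp_less notI) (auto simp: M_def iT_def)
  have mm: "m N < m N'"
    using S.length_pow_mono[of "[X 0]" "m N'" "m N"] le(4) N'(2)
    by (intro not_le_imp_less notI) (auto simp: M_def iS_def)
  have "N > 0" "N \<le> N'" using N N'(2) by (auto simp: N0_def M_def)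
  show ?thesis
  proof (rule exI[of _ "n N' - n N"], rule exI[of _ "m N' - m N"], intro conjI allI impI)
    fix z assume z: "z \<noteq> 0 \<and> \<not> root_of_unity z"
    \<comment> \<open>Both sides are equivalent to the same statement on the substitution given by
      \<open>N\<close> and \<open>\<phi>\<close>, as \<open>\<phi>\<close> respects both
      codings.\<close>
    show "eigenvalue_on A (mat_pow A (subst_matrix \<tau>) (n N' - n N)) z \<longleftrightarrow>
        eigenvalue_on B (mat_pow B (subst_matrix \<sigma>) (m N' - m N)) z"
      using T.eigenvalue_derived_iff[of N "n N" N' "n N'" \<phi> z]
        S.eigenvalue_derived_iff[of N "m N" N' "m N'" \<phi> z]
        \<open>N > 0\<close> \<open>N \<le> N'\<close> le nn mm \<phi> \<phi>\<kappa> \<phi>\<kappa>' z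
      unfolding R_def G_def \<kappa>_def \<kappa>'_def iT_def iS_def by simp
  qed (use nn mm in auto)
qed

end
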